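(* Let $N\ge 2$ and let $\mathscr{T}_{LR}=\mathscr{M}_l+\mathscr{A}_l+\mathscr{M}_r+\mathscr{A}_r$ be the substructured operator of the $N$-strip domain decomposition of the Helmholtz problem in left-right numbering, with $C_r=(I-\mathscr{M}_r)^{-1}\mathscr{A}_r$ and $C_l=(I-\mathscr{M}_l)^{-1}\mathscr{A}_l$. Let $M^{-1}_{BJ}:=(I-\mathscr{M}_r-\mathscr{M}_l)^{-1}$ be the Block Jacobi preconditioner for $I-\mathscr{T}_{LR}$, let $R_{BJ}:=M_{BJ}^{-1}\bigl(M_{BJ}-(I-\mathscr{T}_{LR})\bigr)$ be its error propagation operator, and let $\rho$ denote the spectral radius of $C_r\,C_l$. Then the spectral radius $\rho(R_{BJ})$ of $R_{BJ}$ satisfies $$\rho(R_{BJ})\le\rho^{1/2}.$$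
   Context: Setting. A bounded domain $\Omega\subset\mathbb{R}^2$ is decomposed into $N\ge 2$ successive strips $\Omega_1,\dots,\Omega_N$ (with or without overlap). The part of $\partial\Omega_i\setminus\partial\Omega$ on the left (right) of $\Omega_i$ is the interface $\Gamma_{i,l}$ ($\Gamma_{i,r}$); $\Gamma_{1,l}=\Gamma_{N,r}=\emptyset$. Linear interface operators $\mathcal{B}_{i,l}$ ($2\le i\le N$) and $\mathcal{B}_{i,r}$ ($1\le i\le N-1$) are given, with traces taken on $\Gamma_{i,l}$ and $\Gamma_{i,r}$. For interface functions $h_l,h_r$ and a source $f$, $S_i(h_l,h_r,f)$ denotes the solution $v$ of $(-k^2-\Delta)v=f$ in $\Omega_i$, $\mathcal{B}_{i,l}(v)=h_l$ on $\Gamma_{i,l}$ (if $i\ge2$), $\mathcal{B}_{i,r}(v)=h_r$ on $\Gamma_{i,r}$ (if $i\le N-1$), with fixed linear homogeneous boundary conditions on $\partial\Omega\cap\partial\Omega_i$; these local problems are assumed well posed, so that $S_i$ is linear (for $i=1$ the argument $h_l$ is ignored, for $i=N$ the argument $h_r$ is ignored). Substructured operator. The unknowns are interface functions ordered in the left-right (LR) numbering $(h_{2,l},h_{3,l},\dots,h_{N,l},h_{N-1,r},h_{N-2,r},\dots,h_{1,r})$, i.e. $2N-2$ components. $\mathscr{T}_{LR}$ is the $(2N-2)\times(2N-2)$ matrix of linear operators whose only possibly nonzero entries (row index first, column index second) are $\mathscr{T}_{(i+1,l)(i,l)}=\mathcal{B}_{i+1,l}(S_i(\cdot,0,0))$ for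 $2\le i\le N-1$; $\mathscr{T}_{(i+1,l)(i,r)}=\mathcal{B}_{i+1,l}(S_i(0,\cdot,0))$ for $1\le i\le N-1$; $\mathscr{T}_{(i-1,r)(i,r)}=\mathcal{B}_{i-1,r}(S_i(0,\cdot,0))$ for $2\le i\le N-1$; $\mathscr{T}_{(i-1,r)(i,l)}=\mathcal{B}_{i-1,r}(S_i(\cdot,0,0))$ for $2\le i\le N$. The entries are assumed to be bounded operators between complex Banach spaces of interface functions (e.g. complex matrices after discretization), so that operator norms and spectral radii make sense. Submatrices. $I$ is the identity. Let $I_l$ (resp. $I_r$) be the diagonal $(2N-2)\times(2N-2)$ matrix with diagonal entries $1$ in positions $1,\dots,N-1$ (resp. $N,\dots,2N-2$) and $0$ elsewhere. Set $\mathscr{M}_l:=I_l^T\mathscr{T}_{LR}I_l$, $\mathscr{A}_l:=I_l^T\mathscr{T}_{LR}I_r$, $\mathscr{A}_r:=I_r^T\mathscr{T}_{LR}I_l$, $\mathscr{M}_r:=I_r^T\mathscr{T}_{LR}I_r$. The matrices $\mathscr{M}_l,\mathscr{M}_r$ are strictly lower triangular with $\mathscr{M}_l^{N-1}=\mathscr{M}_r^{N-1}=0$. Define $C_r:=(I-\mathscr{M}_r)^{-1}\mathscr{A}_r=\bigl(\sum_{i=0}^{N-2}\mathscr{M}_r^i\bigr)\mathscr{A}_r$ and $C_l:=(I-\mathscr{M}_l)^{-1}\mathscr{A}_l=\bigl(\sum_{i=0}^{N-2}\mathscr{M}_l^i\bigr)\mathscr{A}_l$. Error propagation operator. For a preconditioner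 $M^{-1}$ (with inverse $M$) of a linear operator $B$, the error propagation operator is $R:=M^{-1}(M-B)$; here $B=I-\mathscr{T}_{LR}$. *)

theory Defs
  imports "HOL-Analysis.Analysis" "HOL-Library.Function_Algebras"
begin

section \<open>Complex vector spaces, complex Banach spaces, spectra\<close>

class complex_vector = ab_group_add +
  fixes scaleC :: "complex \<Rightarrow> 'a \<Rightarrow> 'a"  (infixr "*\<^sub>C" 75)
  assumes scaleC_add_right: "c *\<^sub>C (x + y) = c *\<^sub>C x + c *\<^sub>C y"
    and scaleC_add_left: "(c + d) *\<^sub>C x = c *\<^sub>C x + d *\<^sub>C x"
    and scaleC_scaleC: "c *\<^sub>C d *\<^sub>C x = (c * d) *\<^sub>C x"
    and scaleC_one: "1 *\<^sub>C x = x"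

class complex_banach = complex_vector + banach +
  assumes scaleR_scaleC: "r *\<^sub>R x = complex_of_real r *\<^sub>C x"
    and norm_scaleC: "norm (c *\<^sub>C x) = cmod c * norm x"

instantiation complex :: complex_banach
begin
definition scaleC_complex :: "complex \<Rightarrow> complex \<Rightarrow> complex" where
  "scaleC_complex c x = c * x"
instance
  by standard (simp_all add: scaleC_complex_def algebra_simps scaleR_conv_of_real norm_mult)
end

instantiation "fun" :: (type, complex_vector) complex_vector
begin
definition scaleC_fun :: "complex \<Rightarrow> ('a \<Rightarrow> 'b) \<Rightarrow> 'a \<Rightarrow> 'b" where
  "scaleC_fun c u = (\<lambda>x. c *\<^sub>C u x)"
instance
  by standard
    (simp_all add: scaleC_fun_def fun_eq_iff scaleC_add_right scaleC_add_left scaleC_scaleC scaleC_one)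
end

abbreviation csubspace :: "'a::complex_vector set \<Rightarrow> bool" where
  "csubspace \<equiv> module.subspace scaleC"

definition clinear_on :: "'a::complex_vector set \<Rightarrow> ('a \<Rightarrow> 'b::complex_vector) \<Rightarrow> bool" where
  "clinear_on X T \<longleftrightarrow>
     (\<forall>u\<in>X. \<forall>v\<in>X. T (u + v) = T u + T v) \<and> (\<forall>c. \<forall>u\<in>X. T (c *\<^sub>C u) = c *\<^sub>C T u)"

text \<open>Operators act on a carrier subspace \<open>X\<close> of an ambient space, normed by \<open>nrm\<close>;
  their values outside \<open>X\<close> are irrelevant.\<close>

definition bounded_op_on ::
    "('a::complex_vector \<Rightarrow> real) \<Rightarrow> 'a set \<Rightarrow> ('a \<Rightarrow> 'a) \<Rightarrow> bool" where
  "bounded_op_on nrm X T \<longleftrightarrow>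
     clinear_on X T \<and> T ` X \<subseteq> X \<and> (\<exists>K. \<forall>u\<in>X. nrm (T u) \<le> K * nrm u)"

definition spectrum_on ::
    "('a::complex_vector \<Rightarrow> real) \<Rightarrow> 'a set \<Rightarrow> ('a \<Rightarrow> 'a) \<Rightarrow> complex set" where
  "spectrum_on nrm X T =
     {z. \<not> (\<exists>G. bounded_op_on nrm X G \<and>
              (\<forall>u\<in>X. G (z *\<^sub>C u - T u) = u \<and> z *\<^sub>C G u - T (G u) = u))}"

text \<open>Inserting \<open>0\<close> only matters for \<open>X = {0}\<close>, where the spectrum is empty and the
  spectral radius is \<open>0\<close> by convention.\<close>

definition spectral_radius_on ::
    "('a::complex_vector \<Rightarrow> real) \<Rightarrow> 'a set \<Rightarrow> ('a \<Rightarrow> 'a) \<Rightarrow> real" where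
  "spectral_radius_on nrm X T = Sup (insert 0 (cmod ` spectrum_on nrm X T))"


section \<open>The Helmholtz equation in the sense of distributions\<close>

definition partial_deriv :: "2 \<Rightarrow> (real^2 \<Rightarrow> complex) \<Rightarrow> real^2 \<Rightarrow> complex" where
  "partial_deriv j \<phi> x = vector_derivative (\<lambda>t. \<phi> (x + t *\<^sub>R axis j 1)) (at 0)"

primrec C_k :: "nat \<Rightarrow> (real^2 \<Rightarrow> complex) \<Rightarrow> bool" where
  "C_k 0 \<phi> \<longleftrightarrow> continuous_on UNIV \<phi>"
| "C_k (Suc m) \<phi> \<longleftrightarrow> continuous_on UNIV \<phi> \<and>
     (\<forall>j. (\<forall>x. (\<lambda>t. \<phi> (x + t *\<^sub>R axis j 1)) differentiable (at 0)) \<and> C_k m (partial_deriv j \<phi>))"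

definition laplacian :: "(real^2 \<Rightarrow> complex) \<Rightarrow> real^2 \<Rightarrow> complex" where
  "laplacian \<phi> x = (\<Sum>j\<in>UNIV. partial_deriv j (partial_deriv j \<phi>) x)"

definition test_function :: "(real^2) set \<Rightarrow> (real^2 \<Rightarrow> complex) \<Rightarrow> bool" where
  "test_function U \<phi> \<longleftrightarrow>
     (\<forall>m. C_k m \<phi>) \<and> compact (closure {x. \<phi> x \<noteq> 0}) \<and> closure {x. \<phi> x \<noteq> 0} \<subseteq> U"

definition locally_integrable_on :: "(real^2 \<Rightarrow> complex) \<Rightarrow> (real^2) set \<Rightarrow> bool" where
  "locally_integrable_on v U \<longleftrightarrow>
     (\<forall>K. compact K \<and> K \<subseteq> U \<longrightarrow> v absolutely_integrable_on K)"

text \<open>\<open>(-k\<^sup>2 - \<Delta>) v = f\<close> in \<open>U\<close>, for \<open>v\<close> and \<open>f\<close> locally integrable on \<open>U\<close>.\<close>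

definition helmholtz ::
    "complex \<Rightarrow> (real^2) set \<Rightarrow> (real^2 \<Rightarrow> complex) \<Rightarrow> (real^2 \<Rightarrow> complex) \<Rightarrow> bool" where
  "helmholtz k U v f \<longleftrightarrow>
     (\<forall>\<phi>. test_function U \<phi> \<longrightarrow>
        integral U (\<lambda>x. v x * (- k\<^sup>2 * \<phi> x - laplacian \<phi> x)) = integral U (\<lambda>x. f x * \<phi> x))"


section \<open>Strip decompositions and local problems\<close>

datatype side = Lft | Rgt

text \<open>Functions on a strip are extended by \<open>0\<close>; since equality of functions is pointwise, a
  solution space contains one representative per almost-everywhere class. The interface spaces may all differ: they are
  closed subspaces of one complex Banach space \<open>'h\<close>, for instance of their direct sum.
  The boundary operator of strip \<open>i\<close> expresses the homogeneous conditions \<open>bdry_op D i v = 0\<close>.\<close>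

record ('h, 'b) strip_problem =
  wavenumber :: complex
  nstrips :: nat
  domain :: "(real^2) set"
  strip :: "nat \<Rightarrow> (real^2) set"
  interface :: "nat \<Rightarrow> side \<Rightarrow> (real^2) set"
  sol_space :: "nat \<Rightarrow> (real^2 \<Rightarrow> complex) set"
  source_space :: "nat \<Rightarrow> (real^2 \<Rightarrow> complex) set"
  bdry_op :: "nat \<Rightarrow> (real^2 \<Rightarrow> complex) \<Rightarrow> 'b"
  iface_op :: "nat \<Rightarrow> side \<Rightarrow> (real^2 \<Rightarrow> complex) \<Rightarrow> 'h"
  iface_space :: "nat \<Rightarrow> side \<Rightarrow> 'h set"

text \<open>Strips are numbered from left to right, so the left (right) part of the interior boundary
  of a strip is the part reached by the preceding (following) strip.\<close>

definition strip_decomposition :: "('h, 'b) strip_problem \<Rightarrow> bool" where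
  "strip_decomposition D \<longleftrightarrow>
     (let N = nstrips D; \<Omega> = domain D; \<Omega>s = strip D; \<Gamma> = interface D in
      open \<Omega> \<and> connected \<Omega> \<and> bounded \<Omega> \<and> \<Omega> \<noteq> {} \<and>
      (\<forall>i\<in>{1..N}. open (\<Omega>s i) \<and> \<Omega>s i \<noteq> {} \<and> \<Omega>s i \<subseteq> \<Omega>) \<and>
      closure \<Omega> = (\<Union>i\<in>{1..N}. closure (\<Omega>s i)) \<and>
      (\<forall>i\<in>{1..N}. \<Gamma> i Lft \<union> \<Gamma> i Rgt = frontier (\<Omega>s i) - frontier \<Omega> \<and> \<Gamma> i Lft \<inter> \<Gamma> i Rgt = {}) \<and>
      \<Gamma> 1 Lft = {} \<and> \<Gamma> N Rgt = {} \<and>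
      (\<forall>i\<in>{2..N}. \<Gamma> i Lft \<subseteq> closure (\<Omega>s (i - 1))) \<and>
      (\<forall>i\<in>{1..N - 1}. \<Gamma> i Rgt \<subseteq> closure (\<Omega>s (i + 1))))"

text \<open>\<open>T\<close> takes traces on \<open>G\<close>: its value at a function on \<open>U\<close> depends only on
  the function near \<open>G\<close>.\<close>

definition trace_op_on ::
    "(real^2) set \<Rightarrow> (real^2) set \<Rightarrow> (real^2 \<Rightarrow> complex) set \<Rightarrow> ((real^2 \<Rightarrow> complex) \<Rightarrow> 'b) \<Rightarrow> bool" where
  "trace_op_on G U V T \<longleftrightarrow>
     (\<forall>v\<in>V. \<forall>w\<in>V. (\<exists>W. open W \<and> G \<subseteq> W \<and> (\<forall>x\<in>W \<inter> U. v x = w x)) \<longrightarrow> T v = T w)"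

definition function_spaces ::
    "('h::complex_banach, 'b::complex_vector) strip_problem \<Rightarrow> bool" where
  "function_spaces D \<longleftrightarrow>
     (\<forall>i\<in>{1..nstrips D}.
        csubspace (sol_space D i) \<and> csubspace (source_space D i) \<and>
        (\<forall>v\<in>sol_space D i \<union> source_space D i.
           locally_integrable_on v (strip D i) \<and> (\<forall>x. x \<notin> strip D i \<longrightarrow> v x = 0))) \<and>
     (\<forall>i\<in>{2..nstrips D}. csubspace (iface_space D i Lft) \<and> closed (iface_space D i Lft)) \<and>
     (\<forall>i\<in>{1..nstrips D - 1}. csubspace (iface_space D i Rgt) \<and> closed (iface_space D i Rgt))"

text \<open>The operator on the interface \<open>(i, Lft)\<close> is applied to functions on the strips \<open>i\<close> and
  \<open>i - 1\<close>, the one on \<open>(i, Rgt)\<close> to functions on the strips \<open>i\<close> and \<open>i + 1\<close>.\<close>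

definition interface_operators ::
    "('h::complex_banach, 'b::complex_vector) strip_problem \<Rightarrow> bool" where
  "interface_operators D \<longleftrightarrow>
     (let ok = (\<lambda>i s j.
        clinear_on (sol_space D j) (iface_op D i s) \<and>
        iface_op D i s ` sol_space D j \<subseteq> iface_space D i s \<and>
        trace_op_on (interface D i s) (strip D j) (sol_space D j) (iface_op D i s)) in
      (\<forall>i\<in>{2..nstrips D}. \<forall>j\<in>{i - 1, i}. ok i Lft j) \<and>
      (\<forall>i\<in>{1..nstrips D - 1}. \<forall>j\<in>{i, i + 1}. ok i Rgt j))"

definition boundary_operators ::
    "('h::complex_banach, 'b::complex_vector) strip_problem \<Rightarrow> bool" where
  "boundary_operators D \<longleftrightarrow>
     (\<forall>i\<in>{1..nstrips D}.
        clinear_on (sol_space D i) (bdry_op D i) \<and>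
        trace_op_on (frontier (domain D) \<inter> frontier (strip D i)) (strip D i)
          (sol_space D i) (bdry_op D i))"

definition is_local_solution ::
    "('h::complex_banach, 'b::complex_vector) strip_problem \<Rightarrow> nat \<Rightarrow> 'h \<Rightarrow> 'h \<Rightarrow>
       (real^2 \<Rightarrow> complex) \<Rightarrow> (real^2 \<Rightarrow> complex) \<Rightarrow> bool" where
  "is_local_solution D i hl hr f v \<longleftrightarrow>
     v \<in> sol_space D i \<and>
     helmholtz (wavenumber D) (strip D i) v f \<and>
     (2 \<le> i \<longrightarrow> iface_op D i Lft v = hl) \<and>
     (i \<le> nstrips D - 1 \<longrightarrow> iface_op D i Rgt v = hr) \<and>
     bdry_op D i v = 0"

definition well_posed ::
    "('h::complex_banach, 'b::complex_vector) strip_problem \<Rightarrow> bool" where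
  "well_posed D \<longleftrightarrow>
     (\<forall>i\<in>{1..nstrips D}. \<forall>hl hr. \<forall>f\<in>source_space D i.
        (2 \<le> i \<longrightarrow> hl \<in> iface_space D i Lft) \<longrightarrow>
        (i \<le> nstrips D - 1 \<longrightarrow> hr \<in> iface_space D i Rgt) \<longrightarrow>
        (\<exists>!v. is_local_solution D i hl hr f v))"

definition local_solution ::
    "('h::complex_banach, 'b::complex_vector) strip_problem \<Rightarrow> nat \<Rightarrow> 'h \<Rightarrow> 'h \<Rightarrow>
       (real^2 \<Rightarrow> complex) \<Rightarrow> real^2 \<Rightarrow> complex" where
  "local_solution D i hl hr f = (THE v. is_local_solution D i hl hr f v)"


section \<open>The substructured operator\<close>

text \<open>The left-right numbering \<open>(2,l), \<dots>, (N,l), (N-1,r), \<dots>, (1,r)\<close> of the positions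
  \<open>1, \<dots>, 2N-2\<close>.\<close>

definition lr_index :: "nat \<Rightarrow> nat \<Rightarrow> nat \<times> side" where
  "lr_index N p = (if p \<le> N - 1 then (p + 1, Lft) else (2 * N - 1 - p, Rgt))"

definition positions :: "('h, 'b) strip_problem \<Rightarrow> nat set" where
  "positions D = {1..2 * nstrips D - 2}"

fun T_entry ::
    "('h::complex_banach, 'b::complex_vector) strip_problem \<Rightarrow> nat \<times> side \<Rightarrow> nat \<times> side \<Rightarrow> 'h \<Rightarrow> 'h" where
  "T_entry D (j, Lft) (i, Lft) =
     (if 2 \<le> i \<and> i \<le> nstrips D - 1 \<and> j = i + 1
      then (\<lambda>h. iface_op D j Lft (local_solution D i h 0 0)) else (\<lambda>h. 0))"
| "T_entry D (j, Lft) (i, Rgt) =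
     (if 1 \<le> i \<and> i \<le> nstrips D - 1 \<and> j = i + 1
      then (\<lambda>h. iface_op D j Lft (local_solution D i 0 h 0)) else (\<lambda>h. 0))"
| "T_entry D (j, Rgt) (i, Rgt) =
     (if 2 \<le> i \<and> i \<le> nstrips D - 1 \<and> j = i - 1
      then (\<lambda>h. iface_op D j Rgt (local_solution D i 0 h 0)) else (\<lambda>h. 0))"
| "T_entry D (j, Rgt) (i, Lft) =
     (if 2 \<le> i \<and> i \<le> nstrips D \<and> j = i - 1
      then (\<lambda>h. iface_op D j Rgt (local_solution D i h 0 0)) else (\<lambda>h. 0))"

definition position_space ::
    "('h::complex_banach, 'b::complex_vector) strip_problem \<Rightarrow> nat \<Rightarrow> 'h set" where
  "position_space D p = (case lr_index (nstrips D) p of (i, s) \<Rightarrow> iface_space D i s)"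

definition T_matrix ::
    "('h::complex_banach, 'b::complex_vector) strip_problem \<Rightarrow> nat \<Rightarrow> nat \<Rightarrow> 'h \<Rightarrow> 'h" where
  "T_matrix D p q = T_entry D (lr_index (nstrips D) p) (lr_index (nstrips D) q)"

definition bounded_entries ::
    "('h::complex_banach, 'b::complex_vector) strip_problem \<Rightarrow> bool" where
  "bounded_entries D \<longleftrightarrow>
     (\<forall>p\<in>positions D. \<forall>q\<in>positions D.
        \<exists>K. \<forall>h\<in>position_space D q. norm (T_matrix D p q h) \<le> K * norm h)"

definition helmholtz_strips ::
    "('h::complex_banach, 'b::complex_vector) strip_problem \<Rightarrow> bool" where
  "helmholtz_strips D \<longleftrightarrow>
     strip_decomposition D \<and> function_spaces D \<and> interface_operators D \<and>
     boundary_operators D \<and> well_posed D \<and> bounded_entries D"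

text \<open>A \<open>(2N-2)\<close>-tuple of interface functions is a function on positions that vanishes
  outside \<open>{1..2N-2}\<close>; operator matrices act on these tuples.\<close>

definition unknowns ::
    "('h::complex_banach, 'b::complex_vector) strip_problem \<Rightarrow> (nat \<Rightarrow> 'h) set" where
  "unknowns D =
     {u. (\<forall>p\<in>positions D. u p \<in> position_space D p) \<and> (\<forall>p. p \<notin> positions D \<longrightarrow> u p = 0)}"

definition tuple_norm ::
    "('h::complex_banach, 'b::complex_vector) strip_problem \<Rightarrow> (nat \<Rightarrow> 'h) \<Rightarrow> real" where
  "tuple_norm D u = (\<Sum>p\<in>positions D. norm (u p))"

definition matrix_op ::
    "('h::complex_banach, 'b::complex_vector) strip_problem \<Rightarrow> (nat \<Rightarrow> nat \<Rightarrow> 'h \<Rightarrow> 'h) \<Rightarrow>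
       (nat \<Rightarrow> 'h) \<Rightarrow> nat \<Rightarrow> 'h" where
  "matrix_op D P u p = (if p \<in> positions D then \<Sum>q\<in>positions D. P p q (u q) else 0)"

definition scalar_matrix_op ::
    "('h::complex_banach, 'b::complex_vector) strip_problem \<Rightarrow> (nat \<Rightarrow> nat \<Rightarrow> complex) \<Rightarrow>
       (nat \<Rightarrow> 'h) \<Rightarrow> nat \<Rightarrow> 'h" where
  "scalar_matrix_op D P = matrix_op D (\<lambda>p q h. P p q *\<^sub>C h)"

definition T_LR ::
    "('h::complex_banach, 'b::complex_vector) strip_problem \<Rightarrow> (nat \<Rightarrow> 'h) \<Rightarrow> nat \<Rightarrow> 'h" where
  "T_LR D = matrix_op D (T_matrix D)"

definition I_l :: "('h, 'b) strip_problem \<Rightarrow> nat \<Rightarrow> nat \<Rightarrow> complex" where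
  "I_l D p q = (if p = q \<and> p \<in> {1..nstrips D - 1} then 1 else 0)"

definition I_r :: "('h, 'b) strip_problem \<Rightarrow> nat \<Rightarrow> nat \<Rightarrow> complex" where
  "I_r D p q = (if p = q \<and> p \<in> {nstrips D..2 * nstrips D - 2} then 1 else 0)"

definition transp :: "(nat \<Rightarrow> nat \<Rightarrow> complex) \<Rightarrow> nat \<Rightarrow> nat \<Rightarrow> complex" where
  "transp P p q = P q p"

definition M_l ::
    "('h::complex_banach, 'b::complex_vector) strip_problem \<Rightarrow> (nat \<Rightarrow> 'h) \<Rightarrow> nat \<Rightarrow> 'h" where
  "M_l D = scalar_matrix_op D (transp (I_l D)) \<circ> T_LR D \<circ> scalar_matrix_op D (I_l D)"

definition A_l ::
    "('h::complex_banach, 'b::complex_vector) strip_problem \<Rightarrow> (nat \<Rightarrow> 'h) \<Rightarrow> nat \<Rightarrow> 'h" where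
  "A_l D = scalar_matrix_op D (transp (I_l D)) \<circ> T_LR D \<circ> scalar_matrix_op D (I_r D)"

definition A_r ::
    "('h::complex_banach, 'b::complex_vector) strip_problem \<Rightarrow> (nat \<Rightarrow> 'h) \<Rightarrow> nat \<Rightarrow> 'h" where
  "A_r D = scalar_matrix_op D (transp (I_r D)) \<circ> T_LR D \<circ> scalar_matrix_op D (I_l D)"

definition M_r ::
    "('h::complex_banach, 'b::complex_vector) strip_problem \<Rightarrow> (nat \<Rightarrow> 'h) \<Rightarrow> nat \<Rightarrow> 'h" where
  "M_r D = scalar_matrix_op D (transp (I_r D)) \<circ> T_LR D \<circ> scalar_matrix_op D (I_r D)"

definition op_inverse ::
    "('h::complex_banach, 'b::complex_vector) strip_problem \<Rightarrow> ((nat \<Rightarrow> 'h) \<Rightarrow> nat \<Rightarrow> 'h) \<Rightarrow>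
       (nat \<Rightarrow> 'h) \<Rightarrow> nat \<Rightarrow> 'h" where
  "op_inverse D P = inv_into (unknowns D) P"

definition C_r ::
    "('h::complex_banach, 'b::complex_vector) strip_problem \<Rightarrow> (nat \<Rightarrow> 'h) \<Rightarrow> nat \<Rightarrow> 'h" where
  "C_r D = op_inverse D (id - M_r D) \<circ> A_r D"

definition C_l ::
    "('h::complex_banach, 'b::complex_vector) strip_problem \<Rightarrow> (nat \<Rightarrow> 'h) \<Rightarrow> nat \<Rightarrow> 'h" where
  "C_l D = op_inverse D (id - M_l D) \<circ> A_l D"

text \<open>\<open>error_propagation D P B\<close> is \<open>P\<^sup>-\<^sup>1 (P - B)\<close>, for the preconditioner \<open>P\<^sup>-\<^sup>1\<close> of \<open>B\<close>.\<close>

definition error_propagation ::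
    "('h::complex_banach, 'b::complex_vector) strip_problem \<Rightarrow> ((nat \<Rightarrow> 'h) \<Rightarrow> nat \<Rightarrow> 'h) \<Rightarrow>
       ((nat \<Rightarrow> 'h) \<Rightarrow> nat \<Rightarrow> 'h) \<Rightarrow> (nat \<Rightarrow> 'h) \<Rightarrow> nat \<Rightarrow> 'h" where
  "error_propagation D P B = op_inverse D P \<circ> (P - B)"

definition R_BJ ::
    "('h::complex_banach, 'b::complex_vector) strip_problem \<Rightarrow> (nat \<Rightarrow> 'h) \<Rightarrow> nat \<Rightarrow> 'h" where
  "R_BJ D = error_propagation D (id - M_r D - M_l D) (id - T_LR D)"

definition spectral_radius ::
    "('h::complex_banach, 'b::complex_vector) strip_problem \<Rightarrow> ((nat \<Rightarrow> 'h) \<Rightarrow> nat \<Rightarrow> 'h) \<Rightarrow> real" where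
  "spectral_radius D P = spectral_radius_on (tuple_norm D) (unknowns D) P"

end

theory Submission
  imports Defs
begin

text \<open>
  Write \<open>E\<^sub>l, E\<^sub>r\<close> for the projections onto the left and the right block of interface unknowns and
  \<open>T\<close> for the substructured operator. Since \<open>M\<^sub>l M\<^sub>r = 0\<close>, the Block Jacobi operator factors as
  \<open>I - M\<^sub>r - M\<^sub>l = (I - M\<^sub>l) (I - M\<^sub>r)\<close>. The functions \<open>C\<^sub>l u\<close> lie in the left block,
  so \<open>M\<^sub>r\<close> annihilates them and \<open>(I - M\<^sub>r - M\<^sub>l) (C\<^sub>l u) = A\<^sub>l u\<close>; likewise
  \<open>(I - M\<^sub>r - M\<^sub>l) (C\<^sub>r u) = A\<^sub>r u\<close>. Hence \<open>R\<^sub>B\<^sub>J = C\<^sub>l + C\<^sub>r\<close>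
  (\<open>block_jacobi_splitting\<close>). As \<open>C\<^sub>l\<close> reads only the right block and writes only the left one,
  \<open>C\<^sub>l\<^sup>2 = 0\<close>, and similarly \<open>C\<^sub>r\<^sup>2 = 0\<close>.

  The rest is a statement about two bounded operators \<open>a, b\<close> with \<open>a\<^sup>2 = b\<^sup>2 = 0\<close>: from
  \<open>(a + b)\<^sup>2 = a b + b a\<close> and the fact that \<open>a b\<close> and \<open>b a\<close> have the same nonzero spectrum,
  every nonzero \<open>z\<close> in the spectrum of \<open>a + b\<close> has \<open>z\<^sup>2\<close> in the spectrum of \<open>b a\<close>
  (\<open>spectrum_sum_square_zero\<close>). To pass from spectra to spectral radii, the spectrum of \<open>b a\<close> has to
  be bounded, which is where completeness of the space of unknowns enters
  (\<open>resolvent_of_large\<close>).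

  Two facts about the substructured operator remain. First, \<open>T\<close> is a bounded linear operator
  (\<open>bounded_T_LR\<close>): the local solutions depend linearly on the interface data because sums and
  multiples of solutions are again solutions, and well-posedness makes solutions unique. Secondly,
  \<open>I - M\<^sub>l\<close> and \<open>I - M\<^sub>r\<close> are invertible because the diagonal blocks are strictly lower triangular in
  the left-right numbering (\<open>diagonal_block_nilpotent\<close>): transfer from left to right raises the
  position by one in the left block, and transfer from right to left does so in the right block.
\<close>

section \<open>Complex vector spaces\<close>

lemma csubspace_iff:
  "csubspace S \<longleftrightarrow> 0 \<in> S \<and> (\<forall>x\<in>S. \<forall>y\<in>S. x + y \<in> S) \<and> (\<forall>c. \<forall>x\<in>S. c *\<^sub>C x \<in> S)"
proof -
  have "module (scaleC :: complex \<Rightarrow> 'a \<Rightarrow> 'a)"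
    by standard (simp_all add: scaleC_add_right scaleC_add_left scaleC_scaleC scaleC_one)
  then show ?thesis
    by (rule module.subspace_def)
qed

lemma scaleC_zero_left [simp]: "0 *\<^sub>C (u :: 'a::complex_vector) = 0"
  using scaleC_add_left[of 0 0 u] by simp

lemma scaleC_zero_right [simp]: "c *\<^sub>C (0 :: 'a::complex_vector) = 0"
  using scaleC_add_right[of c "0::'a" 0] by simp

lemma scaleC_minus_one: "(- 1) *\<^sub>C (u :: 'a::complex_vector) = - u"
  using scaleC_add_left[of "- 1" 1 u] by (simp add: scaleC_one eq_neg_iff_add_eq_0)

lemma scaleC_minus_right: "c *\<^sub>C (- u) = - (c *\<^sub>C (u :: 'a::complex_vector))"
  using scaleC_add_right[of c u "- u"] by (simp add: eq_neg_iff_add_eq_0 add.commute)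

lemma scaleC_diff_right: "c *\<^sub>C (u - v) = c *\<^sub>C u - c *\<^sub>C (v :: 'a::complex_vector)"
  using scaleC_add_right[of c u "- v"] by (simp add: scaleC_minus_right)

lemma csubspace_diff:
  fixes u v :: "'a::complex_vector"
  assumes "csubspace S" "u \<in> S" "v \<in> S"
  shows "u - v \<in> S"
proof -
  have "u + (- 1) *\<^sub>C v \<in> S"
    using assms by (simp add: csubspace_iff)
  then show ?thesis
    by (simp add: scaleC_minus_one)
qed

lemma csubspace_sum:
  fixes f :: "'i \<Rightarrow> 'a::complex_vector"
  assumes "csubspace S" and "\<And>i. i \<in> A \<Longrightarrow> f i \<in> S"
  shows "sum f A \<in> S"
  using assms(2)
  by (induction A rule: infinite_finite_induct) (use assms(1) in \<open>auto simp: csubspace_iff\<close>)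

section \<open>Bounded operators on a normed carrier\<close>

text \<open>A subspace on which a seminorm of the ambient space is a norm. Having the seminorm on the
  whole space matches tuples of interface functions, where the norm sees only finitely many
  positions while the ambient space consists of all functions on the natural numbers.\<close>

locale normed_carrier =
  fixes nrm :: "'a::complex_vector \<Rightarrow> real" and X :: "'a set"
  assumes subspace_X: "csubspace X"
    and nrm_nonneg: "0 \<le> nrm u"
    and nrm_triangle: "nrm (u + v) \<le> nrm u + nrm v"
    and nrm_scaleC: "nrm (c *\<^sub>C u) = cmod c * nrm u"
    and nrm_definite: "u \<in> X \<Longrightarrow> nrm u = 0 \<Longrightarrow> u = 0"
begin

abbreviation bop :: "('a \<Rightarrow> 'a) \<Rightarrow> bool"
  where "bop \<equiv> bounded_op_on nrm X"

lemma zero_X: "0 \<in> X"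
  and add_X: "u \<in> X \<Longrightarrow> v \<in> X \<Longrightarrow> u + v \<in> X"
  and scaleC_X: "u \<in> X \<Longrightarrow> c *\<^sub>C u \<in> X"
  and diff_X: "u \<in> X \<Longrightarrow> v \<in> X \<Longrightarrow> u - v \<in> X"
  using subspace_X csubspace_diff by (auto simp: csubspace_iff)

lemma nrm_minus: "nrm (- u) = nrm u"
  using nrm_scaleC[of "- 1" u] by (simp add: scaleC_minus_one)

lemma nrm_zero [simp]: "nrm 0 = 0"
  using nrm_scaleC[of 0 0] by simp

lemma bop_in: "bop T \<Longrightarrow> u \<in> X \<Longrightarrow> T u \<in> X"
  and bop_add: "bop T \<Longrightarrow> u \<in> X \<Longrightarrow> v \<in> X \<Longrightarrow> T (u + v) = T u + T v"
  and bop_scaleC: "bop T \<Longrightarrow> u \<in> X \<Longrightarrow> T (c *\<^sub>C u) = c *\<^sub>C T u"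
  by (auto simp: bounded_op_on_def clinear_on_def)

lemma bop_zero: "bop T \<Longrightarrow> T 0 = 0"
  using bop_scaleC[of T 0 0] zero_X by simp

lemma bop_diff:
  assumes "bop T" "u \<in> X" "v \<in> X"
  shows "T (u - v) = T u - T v"
  using bop_add[OF assms(1,2) scaleC_X[OF assms(3)], of "- 1"] bop_scaleC[OF assms(1,3), of "- 1"]
  by (simp add: scaleC_minus_one)

lemma bopE:
  assumes "bop T"
  obtains K where "0 \<le> K" "\<And>u. u \<in> X \<Longrightarrow> nrm (T u) \<le> K * nrm u"
proof -
  obtain K where K: "\<And>u. u \<in> X \<Longrightarrow> nrm (T u) \<le> K * nrm u"
    using assms by (auto simp: bounded_op_on_def)
  have "nrm (T u) \<le> \<bar>K\<bar> * nrm u" if "u \<in> X" for u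
    using K[OF that] mult_right_mono[OF abs_ge_self nrm_nonneg, of K u] by linarith
  with that[of "\<bar>K\<bar>"] show thesis by simp
qed

lemma bopI:
  assumes "\<And>u v. u \<in> X \<Longrightarrow> v \<in> X \<Longrightarrow> T (u + v) = T u + T v"
    and "\<And>c u. u \<in> X \<Longrightarrow> T (c *\<^sub>C u) = c *\<^sub>C T u"
    and "\<And>u. u \<in> X \<Longrightarrow> T u \<in> X"
    and "\<And>u. u \<in> X \<Longrightarrow> nrm (T u) \<le> K * nrm u"
  shows "bop T"
  using assms unfolding bounded_op_on_def clinear_on_def by blast

lemma bop_id: "bop (\<lambda>u. u)"
  by (auto simp: bounded_op_on_def clinear_on_def intro: exI[of _ 1])

lemma bop_const_zero: "bop (\<lambda>u. 0)"
  by (auto simp: bounded_op_on_def clinear_on_def zero_X intro: exI[of _ 0])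

lemma bop_compose:
  assumes S: "bop S" and T: "bop T"
  shows "bop (\<lambda>u. S (T u))"
proof -
  obtain K where K: "0 \<le> K" "\<And>u. u \<in> X \<Longrightarrow> nrm (S u) \<le> K * nrm u"
    using bopE[OF S] by blast
  obtain L where L: "0 \<le> L" "\<And>u. u \<in> X \<Longrightarrow> nrm (T u) \<le> L * nrm u"
    using bopE[OF T] by blast
  have "nrm (S (T u)) \<le> (K * L) * nrm u" if "u \<in> X" for u
    using K(2)[OF bop_in[OF T that]] mult_left_mono[OF L(2)[OF that] K(1)] by simp
  then show ?thesis
    by (intro bopI) (simp_all add: bop_in[OF S] bop_in[OF T] bop_add[OF S] bop_add[OF T]
        bop_scaleC[OF S] bop_scaleC[OF T])
qed

lemma bop_plus:
  assumes S: "bop S" and T: "bop T"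
  shows "bop (\<lambda>u. S u + T u)"
proof -
  obtain K where K: "0 \<le> K" "\<And>u. u \<in> X \<Longrightarrow> nrm (S u) \<le> K * nrm u"
    using bopE[OF S] by blast
  obtain L where L: "0 \<le> L" "\<And>u. u \<in> X \<Longrightarrow> nrm (T u) \<le> L * nrm u"
    using bopE[OF T] by blast
  have "nrm (S u + T u) \<le> (K + L) * nrm u" if "u \<in> X" for u
    using nrm_triangle[of "S u" "T u"] K(2)[OF that] L(2)[OF that] by (simp add: algebra_simps)
  then show ?thesis
    by (intro bopI) (simp_all add: bop_in[OF S] bop_in[OF T] bop_add[OF S] bop_add[OF T]
        bop_scaleC[OF S] bop_scaleC[OF T] add_X scaleC_add_right)
qed

lemma bop_scale:
  assumes T: "bop T"
  shows "bop (\<lambda>u. c *\<^sub>C T u)"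
proof -
  obtain K where K: "\<And>u. u \<in> X \<Longrightarrow> nrm (T u) \<le> K * nrm u"
    using bopE[OF T] by blast
  have "nrm (c *\<^sub>C T u) \<le> (cmod c * K) * nrm u" if "u \<in> X" for u
    using mult_left_mono[OF K[OF that], of "cmod c"] by (simp add: nrm_scaleC)
  then show ?thesis
    using T by - (rule bopI[of _ "cmod c * K"],
      simp_all only: bop_in bop_add bop_scaleC scaleC_X scaleC_add_right scaleC_scaleC mult.commute)
qed

lemma bop_minus:
  assumes S: "bop S" and T: "bop T"
  shows "bop (\<lambda>u. S u - T u)"
  using bop_plus[OF S bop_scale[OF T, of "- 1"]] by (simp add: scaleC_minus_one)

lemma spectrum_cong:
  assumes eq: "\<And>u. u \<in> X \<Longrightarrow> S u = T u"
  shows "spectrum_on nrm X S = spectrum_on nrm X T"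
proof -
  have "G (z *\<^sub>C u - S u) = u \<and> z *\<^sub>C G u - S (G u) = u \<longleftrightarrow>
      G (z *\<^sub>C u - T u) = u \<and> z *\<^sub>C G u - T (G u) = u" if "bop G" "u \<in> X" for G z u
    using that eq bop_in by simp
  then show ?thesis
    unfolding spectrum_on_def by (intro Collect_cong arg_cong[of _ _ Not] ex_cong1) blast
qed

definition inverse_on_carrier :: "('a \<Rightarrow> 'a) \<Rightarrow> ('a \<Rightarrow> 'a) \<Rightarrow> bool"
  where "inverse_on_carrier P G \<longleftrightarrow> bop G \<and> (\<forall>u\<in>X. G (P u) = u \<and> P (G u) = u)"

lemma spectrum_iff: "z \<in> spectrum_on nrm X T \<longleftrightarrow> \<not> (\<exists>G. inverse_on_carrier (\<lambda>u. z *\<^sub>C u - T u) G)"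
  by (simp add: spectrum_on_def inverse_on_carrier_def)

lemma inv_into_eq:
  assumes "inverse_on_carrier P G" "u \<in> X"
  shows "inv_into X P u = G u"
proof -
  have "inj_on P X"
    using assms(1) unfolding inverse_on_carrier_def by (metis inj_onI)
  then show ?thesis
    using assms inv_into_f_f[of P X "G u"] by (simp add: inverse_on_carrier_def bop_in)
qed

text \<open>The inverse is the finite geometric series \<open>I + M + \<dots> + M\<^sup>n\<^sup>-\<^sup>1\<close>, built up by the
  Horner step \<open>G \<mapsto> I + M G\<close>.\<close>

lemma nilpotent_inverse:
  assumes M: "bop M" and nil: "\<And>u. u \<in> X \<Longrightarrow> (M ^^ n) u = 0"
  shows "\<exists>G. inverse_on_carrier (\<lambda>u. u - M u) G"
proof -
  have "\<exists>G. bop G \<and> (\<forall>u\<in>X. G (u - M u) = u - (M ^^ m) u \<and> G u - M (G u) = u - (M ^^ m) u)" for m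
  proof (induction m)
    case 0
    show ?case
      by (rule exI[of _ "\<lambda>u. 0"]) (simp add: bop_const_zero bop_zero[OF M])
  next
    case (Suc m)
    then obtain G where G: "bop G" "\<And>u. u \<in> X \<Longrightarrow> G (u - M u) = u - (M ^^ m) u"
        "\<And>u. u \<in> X \<Longrightarrow> G u - M (G u) = u - (M ^^ m) u"
      by blast
    have pow: "(M ^^ m) u \<in> X" if "u \<in> X" for u
      by (induction m) (simp_all add: bop_in[OF M] that)
    have "u - M u + M (G (u - M u)) = u - (M ^^ Suc m) u" if "u \<in> X" for u
      using G(2)[OF that] bop_diff[OF M that pow[OF that]] by simp
    moreover have "u + M (G u) - M (u + M (G u)) = u - (M ^^ Suc m) u" if u: "u \<in> X" for u
    proof -
      have in_X: "G u \<in> X" "M (G u) \<in> X"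
        using G(1) M u by (simp_all add: bop_in)
      have "M (G u) - M (M (G u)) = M u - M ((M ^^ m) u)"
        using G(3)[OF u] bop_diff[OF M in_X] bop_diff[OF M u pow[OF u]] by simp
      moreover have "u + M (G u) - M (u + M (G u)) = u - M u + (M (G u) - M (M (G u)))"
        by (simp add: bop_add[OF M u in_X(2)])
      ultimately show ?thesis
        by simp
    qed
    moreover have "bop (\<lambda>u. u + M (G u))"
      by (rule bop_plus[OF bop_id bop_compose[OF M G(1)]])
    ultimately show ?case
      by (intro exI[of _ "\<lambda>u. u + M (G u)"]) simp
  qed
  from this[of n] show ?thesis
    using nil by (simp add: inverse_on_carrier_def)
qed

lemma metric: "Metric_space X (\<lambda>u v. nrm (u - v))"
proof
  show "nrm (u - v) = nrm (v - u)" for u v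
    using nrm_minus[of "u - v"] by simp
  show "nrm (u - v) = 0 \<longleftrightarrow> u = v" if "u \<in> X" "v \<in> X" for u v
    using nrm_definite[OF diff_X[OF that]] by auto
  show "nrm (u - w) \<le> nrm (u - v) + nrm (v - w)" for u v w
    using nrm_triangle[of "u - v" "v - w"] by simp
qed (rule nrm_nonneg)

section \<open>The Block Jacobi splitting\<close>

text \<open>The solution \<open>v\<close> of \<open>v = E T E v + E T F u\<close> lies in the range of \<open>E\<close>, so the
  complementary projection \<open>F\<close> annihilates it. This one fact yields both \<open>C\<^sub>l\<^sup>2 = 0\<close> and
  \<open>M\<^sub>r C\<^sub>l = 0\<close>, and the same with the sides exchanged.\<close>

lemma block_solve_range:
  assumes E: "bop E" "bop F" "bop T" and FE: "\<And>u. u \<in> X \<Longrightarrow> F (E u) = 0"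
    and G: "inverse_on_carrier (\<lambda>u. u - E (T (E u))) G" and u: "u \<in> X"
  shows "F (G (E (T (F u)))) = 0"
proof -
  define v where "v = G (E (T (F u)))"
  have in_X: "T (F u) \<in> X" "v \<in> X" "T (E v) \<in> X"
    using G u by (simp_all add: v_def inverse_on_carrier_def bop_in E)
  have "v - E (T (E v)) = E (T (F u))"
    using G bop_in[OF E(1) in_X(1)] by (simp add: v_def inverse_on_carrier_def)
  then have "v = E (T (F u)) + E (T (E v))"
    by (simp add: diff_eq_eq)
  also have "\<dots> = E (T (F u) + T (E v))"
    using in_X by (simp add: bop_add[OF E(1)])
  finally have "v = E (T (F u) + T (E v))" .
  then have "F v = 0"
    using FE[OF add_X[OF in_X(1,3)]] by simp
  then show ?thesis
    by (simp add: v_def)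
qed

text \<open>In block notation this is \<open>(I - M\<^sub>r - M\<^sub>l)\<^sup>-\<^sup>1 (T - M\<^sub>r - M\<^sub>l) = C\<^sub>l + C\<^sub>r\<close>. The inverse on
  the left exists because \<open>M\<^sub>l M\<^sub>r = 0\<close> turns \<open>I - M\<^sub>r - M\<^sub>l\<close> into the product
  \<open>(I - M\<^sub>l) (I - M\<^sub>r)\<close>.\<close>

lemma block_jacobi_splitting:
  assumes El: "bop El" and Er: "bop Er" and T: "bop T"
    and sum: "\<And>u. u \<in> X \<Longrightarrow> El u + Er u = u"
    and lr: "\<And>u. u \<in> X \<Longrightarrow> El (Er u) = 0" and rl: "\<And>u. u \<in> X \<Longrightarrow> Er (El u) = 0"
    and Gl: "inverse_on_carrier (\<lambda>u. u - El (T (El u))) Gl"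
    and Gr: "inverse_on_carrier (\<lambda>u. u - Er (T (Er u))) Gr"
    and u: "u \<in> X"
  shows "inv_into X (\<lambda>u. u - Er (T (Er u)) - El (T (El u)))
      (T u - Er (T (Er u)) - El (T (El u))) = Gl (El (T (Er u))) + Gr (Er (T (El u)))"
proof -
  define P where "P = (\<lambda>u. u - Er (T (Er u)) - El (T (El u)))"
  have Gs: "bop Gl" "bop Gr"
    using Gl Gr by (simp_all add: inverse_on_carrier_def)
  note ins = bop_in[OF El] bop_in[OF Er] bop_in[OF T] bop_in[OF Gs(1)] bop_in[OF Gs(2)]
    add_X diff_X
  have P_product: "P v = (v - Er (T (Er v))) - El (T (El (v - Er (T (Er v)))))" if "v \<in> X" for v
    using that by (simp add: P_def bop_diff[OF El] lr ins)
  have inv: "inverse_on_carrier P (\<lambda>v. Gr (Gl v))"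
    unfolding inverse_on_carrier_def
  proof (intro conjI ballI)
    show "bop (\<lambda>v. Gr (Gl v))"
      by (rule bop_compose[OF Gs(2,1)])
    fix v assume v: "v \<in> X"
    show "Gr (Gl (P v)) = v"
      using Gl Gr v by (simp add: P_product inverse_on_carrier_def ins)
    show "P (Gr (Gl v)) = v"
      using Gl Gr v by (simp add: P_product inverse_on_carrier_def ins)
  qed
  define a b where "a = Gl (El (T (Er u)))" and "b = Gr (Er (T (El u)))"
  have ab: "a \<in> X" "b \<in> X"
    using u by (simp_all add: a_def b_def ins)
  have "Er a = 0"
    unfolding a_def by (rule block_solve_range[OF El Er T rl Gl u])
  then have Pa: "P a = El (T (Er u))"
    using Gl u by (simp add: P_def a_def inverse_on_carrier_def ins bop_zero[OF Er] bop_zero[OF T])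
  have "El b = 0"
    unfolding b_def by (rule block_solve_range[OF Er El T lr Gr u])
  then have Pb: "P b = Er (T (El u))"
    using Gr u by (simp add: P_def b_def inverse_on_carrier_def ins bop_zero[OF El] bop_zero[OF T])
  have "T u = T (El u) + T (Er u)"
    using sum[OF u] u bop_add[OF T, of "El u" "Er u"] by (simp add: ins)
  then have "T u = (El (T (El u)) + Er (T (El u))) + (El (T (Er u)) + Er (T (Er u)))"
    using sum u by (simp add: ins)
  then have "T u - Er (T (Er u)) - El (T (El u)) = P a + P b"
    by (simp add: Pa Pb)
  also have "\<dots> = P (a + b)"
    using ab unfolding P_def
    by (simp add: bop_add[OF El] bop_add[OF Er] bop_add[OF T] ins)
  finally have "T u - Er (T (Er u)) - El (T (El u)) = P (a + b)" .
  moreover have "P (a + b) \<in> X"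
    using ab by (simp add: P_def ins)
  ultimately have "inv_into X P (T u - Er (T (Er u)) - El (T (El u))) = a + b"
    using inv_into_eq[OF inv] inv add_X[OF ab] by (simp add: inverse_on_carrier_def)
  then show ?thesis
    by (simp add: P_def a_def b_def)
qed

end

section \<open>Spectra and square-zero operators\<close>

locale complete_carrier = normed_carrier +
  assumes complete_X: "Metric_space.mcomplete X (\<lambda>u v. nrm (u - v))"
begin

text \<open>For \<open>\<bar>z\<bar> > K\<close>, solving \<open>z u - T u = y\<close> means finding a fixed point of the contraction
  \<open>u \<mapsto> (y + T u) / z\<close>; the inverse is bounded because
  \<open>nrm (z u - T u) \<ge> (\<bar>z\<bar> - K) nrm u\<close>.\<close>

lemma resolvent_of_large:
  assumes T: "bop T" and K: "0 \<le> K" "\<And>u. u \<in> X \<Longrightarrow> nrm (T u) \<le> K * nrm u"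
    and z: "K < cmod z"
  shows "\<exists>G. inverse_on_carrier (\<lambda>u. z *\<^sub>C u - T u) G"
proof -
  define P where "P u = z *\<^sub>C u - T u" for u
  have P: "bop P"
    unfolding P_def by (rule bop_minus[OF bop_scale[OF bop_id] T])
  have z0: "z \<noteq> 0"
    using K(1) z by auto
  have lower: "(cmod z - K) * nrm u \<le> nrm (P u)" if "u \<in> X" for u
    using nrm_triangle[of "P u" "T u"] K(2)[OF that] by (simp add: P_def nrm_scaleC algebra_simps)
  have inj: "u = v" if "u \<in> X" "v \<in> X" "P u = P v" for u v
  proof -
    have "(cmod z - K) * nrm (u - v) \<le> 0"
      using lower[OF diff_X[OF that(1,2)]] bop_diff[OF P that(1,2)] that(3) by simp
    then have "nrm (u - v) = 0"
      using z nrm_nonneg[of "u - v"] by (simp add: mult_le_0_iff)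
    then show ?thesis
      using nrm_definite[OF diff_X[OF that(1,2)]] by simp
  qed
  have surj: "\<exists>u\<in>X. P u = y" if y: "y \<in> X" for y
  proof -
    define f where "f u = inverse z *\<^sub>C (y + T u)" for u
    have f_X: "f u \<in> X" if "u \<in> X" for u
      using that y T by (simp add: f_def scaleC_X add_X bop_in)
    have contr: "nrm (f u - f v) \<le> (K / cmod z) * nrm (u - v)" if "u \<in> X" "v \<in> X" for u v
    proof -
      have "f u - f v = inverse z *\<^sub>C T (u - v)"
        using bop_diff[OF T that] by (simp add: f_def scaleC_diff_right[symmetric])
      then show ?thesis
        using mult_left_mono[OF K(2)[OF diff_X[OF that]], of "inverse (cmod z)"]
        by (simp add: nrm_scaleC norm_inverse divide_inverse mult.commute mult.left_commute)
    qed
    have "X \<noteq> {}" "f \<in> X \<rightarrow> X" "K / cmod z < 1"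
      using f_X zero_X z K(1) z0 by (auto simp: divide_less_eq)
    then obtain u where u: "u \<in> X" "f u = u"
      using contr
      by (rule Metric_space.Banach_fixedpoint_thm
          [where f = f and k = "K / cmod z", OF metric complete_X])
    then have "z *\<^sub>C u = y + T u"
      using z0 by (metis f_def right_inverse scaleC_one scaleC_scaleC)
    then show ?thesis
      using u(1) by (auto simp: P_def intro!: bexI[of _ u])
  qed
  define G where "G = inv_into X P"
  have img: "P ` X = X"
    using surj bop_in[OF P] by (force simp: image_iff)
  have GP: "G (P u) = u" if "u \<in> X" for u
    unfolding G_def using that inj by (intro inv_into_f_f inj_onI)
  have PG: "P (G u) = u" "G u \<in> X" if "u \<in> X" for u
    unfolding G_def using that img by (auto intro: f_inv_into_f inv_into_into)
  have "bop G"
  proof (rule bopI)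
    fix u v assume "u \<in> X" "v \<in> X"
    then show "G (u + v) = G u + G v"
      by - (rule inj, simp_all add: PG add_X bop_add[OF P])
  next
    fix c u assume "u \<in> X"
    then show "G (c *\<^sub>C u) = c *\<^sub>C G u"
      by - (rule inj, simp_all add: PG scaleC_X bop_scaleC[OF P])
  next
    fix u assume u: "u \<in> X"
    show "G u \<in> X"
      by (rule PG(2)[OF u])
    show "nrm (G u) \<le> inverse (cmod z - K) * nrm u"
      using lower[OF PG(2)[OF u]] PG(1)[OF u] z by (simp add: divide_simps mult.commute)
  qed
  then show ?thesis
    using GP PG unfolding inverse_on_carrier_def P_def by blast
qed

text \<open>A supremum of reals is meaningful only for bounded sets, so this upper bound rests on the
  boundedness of the spectrum.\<close>

lemma cmod_le_spectral_radius:
  assumes "bop T" and "z \<in> spectrum_on nrm X T"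
  shows "cmod z \<le> spectral_radius_on nrm X T"
proof -
  obtain K where K: "0 \<le> K" "\<And>u. u \<in> X \<Longrightarrow> nrm (T u) \<le> K * nrm u"
    using bopE[OF assms(1)] by blast
  have "cmod w \<le> K" if "w \<in> spectrum_on nrm X T" for w
    using that resolvent_of_large[OF assms(1) K, of w] by (force simp: spectrum_iff)
  then have "bdd_above (insert 0 (cmod ` spectrum_on nrm X T))"
    by (auto intro!: bdd_aboveI[of _ K])
  then show ?thesis
    unfolding spectral_radius_on_def using assms(2) by (intro cSup_upper) auto
qed

lemma spectral_radius_nonneg:
  assumes "bop T"
  shows "0 \<le> spectral_radius_on nrm X T"
proof (cases "spectrum_on nrm X T = {}")
  case True
  then show ?thesis
    by (simp add: spectral_radius_on_def)
next
  case False
  then show ?thesis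
    using cmod_le_spectral_radius[OF assms] norm_ge_zero order_trans by blast
qed

text \<open>With \<open>H = (z\<^sup>2 - b a)\<^sup>-\<^sup>1\<close>, the resolvent of \<open>a + b\<close> at \<open>z\<close> is
  \<open>z H + z\<^sup>-\<^sup>1 a H b + a H + H b\<close>. It comes from \<open>(z - R)\<^sup>-\<^sup>1 = (z + R) (z\<^sup>2 - R\<^sup>2)\<^sup>-\<^sup>1\<close>
  for \<open>R = a + b\<close>, where \<open>z\<^sup>2 - R\<^sup>2 = z\<^sup>-\<^sup>2 (z\<^sup>2 - a b) (z\<^sup>2 - b a)\<close>, and
  \<open>(z\<^sup>2 - a b)\<^sup>-\<^sup>1 = z\<^sup>-\<^sup>2 (1 + a H b)\<close>. The products
  that occur are reduced with \<open>H a = z\<^sup>-\<^sup>2 a\<close> and \<open>b H = z\<^sup>-\<^sup>2 b\<close>, both consequences of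
  \<open>a\<^sup>2 = b\<^sup>2 = 0\<close>.\<close>

lemma spectrum_sum_square_zero:
  assumes a: "bop a" and b: "bop b"
    and aa: "\<And>u. u \<in> X \<Longrightarrow> a (a u) = 0" and bb: "\<And>u. u \<in> X \<Longrightarrow> b (b u) = 0"
    and z: "z \<in> spectrum_on nrm X (\<lambda>u. a u + b u)" "z \<noteq> 0"
  shows "z\<^sup>2 \<in> spectrum_on nrm X (\<lambda>u. b (a u))"
proof (rule ccontr)
  assume "z\<^sup>2 \<notin> spectrum_on nrm X (\<lambda>u. b (a u))"
  then obtain H where H: "bop H"
    and left: "\<And>u. u \<in> X \<Longrightarrow> H (z\<^sup>2 *\<^sub>C u - b (a u)) = u"
    and right: "\<And>u. u \<in> X \<Longrightarrow> z\<^sup>2 *\<^sub>C H u - b (a (H u)) = u"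
    unfolding spectrum_iff inverse_on_carrier_def by auto
  define w where "w = inverse z"
  have w: "z * w = 1" "w * z = 1" "z * (w * c) = c" "w * (z * c) = c" for c
    using z(2) by (simp_all add: w_def)
  note lin = bop_in[OF a] bop_in[OF b] bop_in[OF H] add_X diff_X scaleC_X
    bop_add[OF a] bop_add[OF b] bop_add[OF H] bop_diff[OF a] bop_diff[OF b] bop_diff[OF H]
    bop_scaleC[OF a] bop_scaleC[OF b] bop_scaleC[OF H] bop_zero[OF a] bop_zero[OF b] bop_zero[OF H]
    scaleC_add_right scaleC_diff_right scaleC_scaleC scaleC_one
  have left': "H (b (a u)) = (z * z) *\<^sub>C H u - u" if "u \<in> X" for u
    using left[OF that] that by (simp add: lin power2_eq_square algebra_simps)
  have right': "b (a (H u)) = (z * z) *\<^sub>C H u - u" if "u \<in> X" for u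
    using right[OF that] by (simp add: power2_eq_square algebra_simps)
  have Ha: "(z * z) *\<^sub>C H (a u) = a u" if "u \<in> X" for u
    using left'[of "a u"] that by (simp add: lin aa)
  have bH: "(z * z) *\<^sub>C b (H u) = b u" if u: "u \<in> X" for u
  proof -
    have "b (b (a (H u))) = 0"
      using u by (simp add: bb lin)
    then show ?thesis
      using u by (simp add: right' lin)
  qed
  have Ha': "z *\<^sub>C H (a u) = w *\<^sub>C a u" if "u \<in> X" for u
    using arg_cong[OF Ha[OF that], of "\<lambda>v. w *\<^sub>C v"] by (simp add: scaleC_scaleC w)
  have bH': "z *\<^sub>C b (H u) = w *\<^sub>C b u" if "u \<in> X" for u
    using arg_cong[OF bH[OF that], of "\<lambda>v. w *\<^sub>C v"] by (simp add: scaleC_scaleC w)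
  have aHa: "a (H (a u)) = 0" if u: "u \<in> X" for u
  proof -
    have "z *\<^sub>C a (H (a u)) = a (w *\<^sub>C a u)"
      using u Ha'[OF u] by (metis bop_scaleC[OF a] bop_in[OF a] bop_in[OF H])
    also have "\<dots> = 0"
      using u by (simp add: lin aa)
    finally have "(w * z) *\<^sub>C a (H (a u)) = w *\<^sub>C 0"
      by (metis scaleC_scaleC)
    then show ?thesis
      by (simp add: w scaleC_one)
  qed
  have bHb: "b (H (b u)) = 0" if u: "u \<in> X" for u
  proof -
    have "z *\<^sub>C b (H (b u)) = 0"
      using u bH'[of "b u"] by (simp add: lin bb)
    then have "(w * z) *\<^sub>C b (H (b u)) = w *\<^sub>C 0"
      by (metis scaleC_scaleC)
    then show ?thesis
      by (simp add: w scaleC_one)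
  qed
  define G where "G u = z *\<^sub>C H u + w *\<^sub>C a (H (b u)) + a (H u) + H (b u)" for u
  have "bop G"
    unfolding G_def
    by (rule bop_plus[OF bop_plus[OF bop_plus[OF bop_scale[OF H]
        bop_scale[OF bop_compose[OF a bop_compose[OF H b]]]] bop_compose[OF a H]] bop_compose[OF H b]])
  moreover have "G (z *\<^sub>C u - (a u + b u)) = u" if u: "u \<in> X" for u
    using u by (simp add: G_def lin aHa bHb aa bb left' Ha' w algebra_simps)
  moreover have "z *\<^sub>C G u - (a (G u) + b (G u)) = u" if u: "u \<in> X" for u
    using u by (simp add: G_def lin aHa bHb aa bb right' bH' w algebra_simps)
  ultimately show False
    using z(1) unfolding spectrum_iff inverse_on_carrier_def by blast
qed

lemma spectral_radius_sum_square_zero: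
  assumes a: "bop a" and b: "bop b"
    and aa: "\<And>u. u \<in> X \<Longrightarrow> a (a u) = 0" and bb: "\<And>u. u \<in> X \<Longrightarrow> b (b u) = 0"
  shows "spectral_radius_on nrm X (\<lambda>u. a u + b u) \<le> sqrt (spectral_radius_on nrm X (\<lambda>u. b (a u)))"
proof -
  let ?r = "spectral_radius_on nrm X (\<lambda>u. b (a u))"
  have ba: "bop (\<lambda>u. b (a u))"
    by (rule bop_compose[OF b a])
  have "cmod z \<le> sqrt ?r" if z: "z \<in> spectrum_on nrm X (\<lambda>u. a u + b u)" for z
  proof (cases "z = 0")
    case True
    then show ?thesis
      using spectral_radius_nonneg[OF ba] by simp
  next
    case False
    then have "cmod (z\<^sup>2) \<le> ?r"
      using cmod_le_spectral_radius[OF ba spectrum_sum_square_zero[OF assms z]] by simp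
    then show ?thesis
      by (simp add: norm_power real_le_rsqrt)
  qed
  then show ?thesis
    unfolding spectral_radius_on_def[of nrm X "\<lambda>u. a u + b u"]
    using spectral_radius_nonneg[OF ba] by (intro cSup_least) auto
qed

end

section \<open>Linearity of the Helmholtz equation\<close>

lemma continuous_laplacian:
  assumes "C_k (Suc (Suc m)) \<phi>"
  shows "continuous_on UNIV (laplacian \<phi>)"
proof -
  have "continuous_on UNIV (partial_deriv j (partial_deriv j \<phi>))" for j
    using assms by (cases m) auto
  then show ?thesis
    unfolding laplacian_def by (intro continuous_on_sum)
qed

lemma partial_deriv_zero:
  assumes "open V" and "\<And>x. x \<in> V \<Longrightarrow> \<phi> x = 0" and "x \<in> V"
  shows "partial_deriv j \<phi> x = 0"
proof -
  let ?g = "\<lambda>t. x + t *\<^sub>R axis j (1::real)"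
  have "open (?g -` V)"
    by (intro open_vimage[OF assms(1)] continuous_intros)
  moreover have "((\<lambda>t. 0) has_vector_derivative (0::complex)) (at (0::real))"
    by simp
  ultimately have "((\<lambda>t. \<phi> (?g t)) has_vector_derivative 0) (at 0)"
    using assms(2,3)
    by (elim has_vector_derivative_transform_within_open) auto
  then show ?thesis
    unfolding partial_deriv_def by (rule vector_derivative_at)
qed

lemma laplacian_zero:
  assumes "open V" and "\<And>x. x \<in> V \<Longrightarrow> \<phi> x = 0" and "x \<in> V"
  shows "laplacian \<phi> x = 0"
  unfolding laplacian_def
  by (intro sum.neutral ballI partial_deriv_zero[OF assms(1)] assms(2,3)) auto

text \<open>Integration is additive only on integrable functions, so adding two distributional
  solutions requires this: a locally integrable function is paired with a continuous function that
  vanishes off the compact support of \<open>\<phi>\<close>.\<close>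

lemma test_pairing_integrable:
  assumes v: "locally_integrable_on v U" and \<phi>: "test_function U \<phi>"
  shows "(\<lambda>x. v x * (- k\<^sup>2 * \<phi> x - laplacian \<phi> x)) integrable_on U"
proof -
  let ?\<psi> = "\<lambda>x. - k\<^sup>2 * \<phi> x - laplacian \<phi> x"
  define K where "K = closure {x. \<phi> x \<noteq> 0}"
  have K: "compact K" "K \<subseteq> U" and smooth: "C_k m \<phi>" for m
    using \<phi> by (auto simp: test_function_def K_def)
  have op: "open (- K)"
    by (simp add: K_def open_Compl)
  have off: "\<phi> x = 0" if "x \<in> - K" for x
    using that closure_subset[of "{x. \<phi> x \<noteq> 0}"] unfolding K_def by blast
  have zero: "?\<psi> x = 0" if "x \<notin> K" for x
    using laplacian_zero[OF op off] off[of x] that by simp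
  have "continuous_on UNIV ?\<psi>"
    using smooth[of 0] continuous_laplacian[OF smooth] by (intro continuous_intros) auto
  then have cont: "continuous_on K ?\<psi>"
    by (rule continuous_on_subset) simp
  have meas: "K \<in> sets lebesgue"
    using K(1) by (simp add: compact_imp_closed)
  have "bilinear (\<lambda>a b::complex. b * a)"
    using bounded_bilinear.flip[OF bounded_bilinear_mult]
    by (simp add: bilinear_conv_bounded_bilinear)
  then have "(\<lambda>x. v x * ?\<psi> x) absolutely_integrable_on K"
    using K v by (intro absolutely_integrable_bounded_measurable_product[where h = "\<lambda>a b. b * a"]
        continuous_imp_measurable_on_sets_lebesgue[OF cont meas] meas
        compact_imp_bounded[OF compact_continuous_image[OF cont]])
      (auto simp: locally_integrable_on_def)
  then have "(\<lambda>x. v x * ?\<psi> x) integrable_on K"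
    by (rule set_lebesgue_integral_eq_integral)
  then show ?thesis
    by (rule integrable_on_superset) (use zero K(2) in auto)
qed

lemma helmholtz_add:
  assumes "locally_integrable_on v U" "locally_integrable_on w U"
    and "helmholtz k U v 0" "helmholtz k U w 0"
  shows "helmholtz k U (v + w) 0"
proof -
  have "integral U (\<lambda>x. v x * (- k\<^sup>2 * \<phi> x - laplacian \<phi> x) + w x * (- k\<^sup>2 * \<phi> x - laplacian \<phi> x)) = 0"
    if \<phi>: "test_function U \<phi>" for \<phi>
    using assms(3,4) \<phi>
    by (subst integral_add[OF test_pairing_integrable[OF assms(1) \<phi>] test_pairing_integrable[OF assms(2) \<phi>]])
      (simp add: helmholtz_def)
  then show ?thesis
    by (simp add: helmholtz_def distrib_right)
qed

lemma helmholtz_scaleC: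
  assumes "helmholtz k U v 0"
  shows "helmholtz k U (c *\<^sub>C v) 0"
  using assms by (simp add: helmholtz_def scaleC_fun_def scaleC_complex_def mult.assoc)

section \<open>Local solution operators\<close>

definition linear_between ::
    "'h::complex_vector set \<Rightarrow> 'k::complex_vector set \<Rightarrow> ('h \<Rightarrow> 'k) \<Rightarrow> bool" where
  "linear_between V W A \<longleftrightarrow> clinear_on V A \<and> A ` V \<subseteq> W"

lemma linear_between_zero: "csubspace W \<Longrightarrow> linear_between V W (\<lambda>h. 0)"
  by (auto simp: linear_between_def clinear_on_def csubspace_iff)

locale strip_system =
  fixes D :: "('h::complex_banach, 'b::complex_vector) strip_problem"
  assumes N: "2 \<le> nstrips D" and strips: "helmholtz_strips D"
begin

lemma components:
  "function_spaces D" "interface_operators D" "boundary_operators D" "well_posed D"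
  "bounded_entries D"
  using strips by (simp_all add: helmholtz_strips_def)

lemma iface_space:
  "2 \<le> i \<Longrightarrow> i \<le> nstrips D \<Longrightarrow> csubspace (iface_space D i Lft) \<and> closed (iface_space D i Lft)"
  "1 \<le> i \<Longrightarrow> i \<le> nstrips D - 1 \<Longrightarrow> csubspace (iface_space D i Rgt) \<and> closed (iface_space D i Rgt)"
  using components(1) by (auto simp: function_spaces_def)

lemma sol_space:
  assumes "1 \<le> i" "i \<le> nstrips D"
  shows "csubspace (sol_space D i)" "0 \<in> source_space D i"
    "v \<in> sol_space D i \<Longrightarrow> locally_integrable_on v (strip D i)"
    "clinear_on (sol_space D i) (bdry_op D i)"
  using components(1,3) assms by (auto simp: function_spaces_def csubspace_iff boundary_operators_def)

lemma iface_op: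
  "2 \<le> i \<Longrightarrow> i \<le> nstrips D \<Longrightarrow> j = i - 1 \<or> j = i \<Longrightarrow>
    clinear_on (sol_space D j) (iface_op D i Lft) \<and>
    iface_op D i Lft ` sol_space D j \<subseteq> iface_space D i Lft"
  "1 \<le> i \<Longrightarrow> i \<le> nstrips D - 1 \<Longrightarrow> j = i \<or> j = i + 1 \<Longrightarrow>
    clinear_on (sol_space D j) (iface_op D i Rgt) \<and>
    iface_op D i Rgt ` sol_space D j \<subseteq> iface_space D i Rgt"
  using components(2)
  unfolding interface_operators_def Let_def Ball_def atLeastAtMost_iff insert_iff by blast+

text \<open>The interface conditions that \<open>well_posed\<close> imposes on the data of strip \<open>i\<close>; on the first
  and last strip one of the two arguments is unconstrained.\<close>

definition admissible :: "nat \<Rightarrow> 'h \<Rightarrow> 'h \<Rightarrow> bool" where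
  "admissible i hl hr \<longleftrightarrow> 1 \<le> i \<and> i \<le> nstrips D \<and>
     (2 \<le> i \<longrightarrow> hl \<in> iface_space D i Lft) \<and> (i \<le> nstrips D - 1 \<longrightarrow> hr \<in> iface_space D i Rgt)"

lemma local_solution_unique:
  assumes "admissible i hl hr" "is_local_solution D i hl hr 0 v"
  shows "local_solution D i hl hr 0 = v"
proof -
  have ex1: "\<exists>!v. is_local_solution D i hl hr 0 v"
    using assms(1) components(4) sol_space(2)[of i] unfolding well_posed_def admissible_def by auto
  show ?thesis
    unfolding local_solution_def by (rule the1_equality[OF ex1]) (rule assms(2))
qed

lemma local_solution_solves:
  assumes "admissible i hl hr"
  shows "is_local_solution D i hl hr 0 (local_solution D i hl hr 0)"
proof -
  have "\<exists>!v. is_local_solution D i hl hr 0 v"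
    using assms(1) components(4) sol_space(2)[of i] unfolding well_posed_def admissible_def by auto
  then show ?thesis
    unfolding local_solution_def by (rule theI')
qed

lemma local_solution_add:
  assumes a: "admissible i hl hr" and b: "admissible i gl gr"
  shows "local_solution D i (hl + gl) (hr + gr) 0 = local_solution D i hl hr 0 + local_solution D i gl gr 0"
proof (rule local_solution_unique)
  have i: "1 \<le> i" "i \<le> nstrips D"
    using a by (auto simp: admissible_def)
  show "admissible i (hl + gl) (hr + gr)"
    using a b iface_space[of i] by (auto simp: admissible_def csubspace_iff)
  note sols = local_solution_solves[OF a] local_solution_solves[OF b]
  show "is_local_solution D i (hl + gl) (hr + gr) 0 (local_solution D i hl hr 0 + local_solution D i gl gr 0)"
    unfolding is_local_solution_def
  proof (intro conjI impI)
    show "helmholtz (wavenumber D) (strip D i) (local_solution D i hl hr 0 + local_solution D i gl gr 0) 0"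
      using sols i by (intro helmholtz_add sol_space) (auto simp: is_local_solution_def)
    show "local_solution D i hl hr 0 + local_solution D i gl gr 0 \<in> sol_space D i"
      using sols sol_space(1)[OF i] by (auto simp: is_local_solution_def csubspace_iff)
    show "iface_op D i Lft (local_solution D i hl hr 0 + local_solution D i gl gr 0) = hl + gl" if "2 \<le> i"
      using that sols iface_op(1)[of i i] i by (auto simp: is_local_solution_def clinear_on_def)
    show "iface_op D i Rgt (local_solution D i hl hr 0 + local_solution D i gl gr 0) = hr + gr"
      if "i \<le> nstrips D - 1"
      using that sols iface_op(2)[of i i] i by (auto simp: is_local_solution_def clinear_on_def)
    show "bdry_op D i (local_solution D i hl hr 0 + local_solution D i gl gr 0) = 0"
      using sols sol_space(4)[OF i] by (auto simp: is_local_solution_def clinear_on_def)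
  qed
qed

lemma local_solution_scaleC:
  assumes a: "admissible i hl hr"
  shows "local_solution D i (c *\<^sub>C hl) (c *\<^sub>C hr) 0 = c *\<^sub>C local_solution D i hl hr 0"
proof (rule local_solution_unique)
  have i: "1 \<le> i" "i \<le> nstrips D"
    using a by (auto simp: admissible_def)
  show "admissible i (c *\<^sub>C hl) (c *\<^sub>C hr)"
    using a iface_space[of i] by (auto simp: admissible_def csubspace_iff)
  note sol = local_solution_solves[OF a]
  show "is_local_solution D i (c *\<^sub>C hl) (c *\<^sub>C hr) 0 (c *\<^sub>C local_solution D i hl hr 0)"
    unfolding is_local_solution_def
  proof (intro conjI impI)
    show "helmholtz (wavenumber D) (strip D i) (c *\<^sub>C local_solution D i hl hr 0) 0"
      using sol by (intro helmholtz_scaleC) (auto simp: is_local_solution_def)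
    show "c *\<^sub>C local_solution D i hl hr 0 \<in> sol_space D i"
      using sol sol_space(1)[OF i] by (auto simp: is_local_solution_def csubspace_iff)
    show "iface_op D i Lft (c *\<^sub>C local_solution D i hl hr 0) = c *\<^sub>C hl" if "2 \<le> i"
      using that sol iface_op(1)[of i i] i by (auto simp: is_local_solution_def clinear_on_def)
    show "iface_op D i Rgt (c *\<^sub>C local_solution D i hl hr 0) = c *\<^sub>C hr" if "i \<le> nstrips D - 1"
      using that sol iface_op(2)[of i i] i by (auto simp: is_local_solution_def clinear_on_def)
    show "bdry_op D i (c *\<^sub>C local_solution D i hl hr 0) = 0"
      using sol sol_space(4)[OF i] by (auto simp: is_local_solution_def clinear_on_def)
  qed
qed

text \<open>The entries of the substructured operator all have this shape: solve on strip \<open>i\<close> with data on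
  one interface, then apply an interface operator of a neighbouring strip.\<close>

lemma linear_between_left:
  assumes i: "1 \<le> i" "i \<le> nstrips D" "2 \<le> i"
    and B: "clinear_on (sol_space D i) B \<and> B ` sol_space D i \<subseteq> W"
  shows "linear_between (iface_space D i Lft) W (\<lambda>h. B (local_solution D i h 0 0))"
proof -
  let ?S = "\<lambda>h. local_solution D i h 0 0"
  have adm: "admissible i h 0" if "h \<in> iface_space D i Lft" for h
    using that i iface_space[of i] by (auto simp: admissible_def csubspace_iff)
  have sol: "?S h \<in> sol_space D i" if "h \<in> iface_space D i Lft" for h
    using local_solution_solves[OF adm[OF that]] by (simp add: is_local_solution_def)
  have add: "?S (h + g) = ?S h + ?S g"
    if "h \<in> iface_space D i Lft" "g \<in> iface_space D i Lft" for h g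
    using local_solution_add[OF adm[OF that(1)] adm[OF that(2)]] by simp
  have scale: "?S (c *\<^sub>C h) = c *\<^sub>C ?S h" if "h \<in> iface_space D i Lft" for h c
    using local_solution_scaleC[OF adm[OF that], of c] by simp
  show ?thesis
    using B sol by (auto simp: linear_between_def clinear_on_def add scale)
qed

lemma linear_between_right:
  assumes i: "1 \<le> i" "i \<le> nstrips D" "i \<le> nstrips D - 1"
    and B: "clinear_on (sol_space D i) B \<and> B ` sol_space D i \<subseteq> W"
  shows "linear_between (iface_space D i Rgt) W (\<lambda>h. B (local_solution D i 0 h 0))"
proof -
  let ?S = "\<lambda>h. local_solution D i 0 h 0"
  have adm: "admissible i 0 h" if "h \<in> iface_space D i Rgt" for h
    using that i iface_space[of i] by (auto simp: admissible_def csubspace_iff)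
  have sol: "?S h \<in> sol_space D i" if "h \<in> iface_space D i Rgt" for h
    using local_solution_solves[OF adm[OF that]] by (simp add: is_local_solution_def)
  have add: "?S (h + g) = ?S h + ?S g"
    if "h \<in> iface_space D i Rgt" "g \<in> iface_space D i Rgt" for h g
    using local_solution_add[OF adm[OF that(1)] adm[OF that(2)]] by simp
  have scale: "?S (c *\<^sub>C h) = c *\<^sub>C ?S h" if "h \<in> iface_space D i Rgt" for h c
    using local_solution_scaleC[OF adm[OF that], of c] by simp
  show ?thesis
    using B sol by (auto simp: linear_between_def clinear_on_def add scale)
qed

section \<open>The substructured operator\<close>

lemma lr_index_cases:
  assumes "p \<in> positions D"
  obtains "p \<le> nstrips D - 1" "lr_index (nstrips D) p = (p + 1, Lft)" "2 \<le> p + 1" "p + 1 \<le> nstrips D"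
  | i where "lr_index (nstrips D) p = (i, Rgt)"
      "1 \<le> i" "i \<le> nstrips D - 1"
  using assms N by (cases "p \<le> nstrips D - 1") (auto simp: positions_def lr_index_def)

lemma position_space:
  assumes "p \<in> positions D"
  shows "csubspace (position_space D p)" "closed (position_space D p)"
  using assms by (cases p rule: lr_index_cases; simp add: position_space_def iface_space)+

lemma T_matrix_linear:
  assumes p: "p \<in> positions D" and q: "q \<in> positions D"
  shows "linear_between (position_space D q) (position_space D p) (T_matrix D p q)"
  using p
proof (cases p rule: lr_index_cases)
  case 1
  note p' = this
  show ?thesis
    using q
  proof (cases q rule: lr_index_cases)
    case 1
    show ?thesis
    proof (cases "q + 1 \<le> nstrips D - 1 \<and> p + 1 = q + 1 + 1")
      case True
      have "linear_between (iface_space D (q+1) Lft) (iface_space D (p+1) Lft)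
          (\<lambda>h. iface_op D (p+1) Lft (local_solution D (q+1) h 0 0))"
        using True 1 p' 
        by (intro linear_between_left[where B = "iface_op D (p+1) Lft"] iface_op(1)) auto
      then show ?thesis
        using True 1 p' by (simp add: T_matrix_def position_space_def)
    qed (use 1 p' iface_space in \<open>auto simp: T_matrix_def position_space_def linear_between_zero\<close>)
  next
    case (2 i)
    show ?thesis
    proof (cases "p + 1 = i + 1")
      case True
      have "linear_between (iface_space D i Rgt) (iface_space D (p+1) Lft)
          (\<lambda>h. iface_op D (p+1) Lft (local_solution D i 0 h 0))"
        using True 2 p' 
        by (intro linear_between_right[where B = "iface_op D (p+1) Lft"] iface_op(1)) auto
      then show ?thesis
        using True 2 p' by (simp add: T_matrix_def position_space_def)
    qed (use 2 p' iface_space in \<open>auto simp: T_matrix_def position_space_def linear_between_zero\<close>)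
  qed
next
  case (2 j)
  note p' = this
  show ?thesis
    using q
  proof (cases q rule: lr_index_cases)
    case 1
    show ?thesis
    proof (cases "j = q + 1 - 1")
      case True
      have "linear_between (iface_space D (q+1) Lft) (iface_space D j Rgt)
          (\<lambda>h. iface_op D j Rgt (local_solution D (q+1) h 0 0))"
        using True 1 p' 
        by (intro linear_between_left[where B = "iface_op D j Rgt"] iface_op(2)) auto
      then show ?thesis
        using True 1 p' by (simp add: T_matrix_def position_space_def)
    qed (use 1 p' iface_space in \<open>auto simp: T_matrix_def position_space_def linear_between_zero\<close>)
  next
    case (2 i)
    show ?thesis
    proof (cases "2 \<le> i \<and> j = i - 1")
      case True
      have "linear_between (iface_space D i Rgt) (iface_space D j Rgt)
          (\<lambda>h. iface_op D j Rgt (local_solution D i 0 h 0))"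
        using True 2 p' 
        by (intro linear_between_right[where B = "iface_op D j Rgt"] iface_op(2)) auto
      then show ?thesis
        using True 2 p' by (simp add: T_matrix_def position_space_def)
    qed (use 2 p' iface_space in \<open>auto simp: T_matrix_def position_space_def linear_between_zero\<close>)
  qed
qed

lemma unknowns_subspace: "csubspace (unknowns D)"
  using position_space(1) by (auto simp: csubspace_iff unknowns_def scaleC_fun_def)

lemma finite_positions [simp]: "finite (positions D)"
  by (simp add: positions_def)

lemma norm_le_tuple_norm: "p \<in> positions D \<Longrightarrow> norm (u p) \<le> tuple_norm D u"
  unfolding tuple_norm_def by (rule member_le_sum) auto

lemma normed_unknowns: "normed_carrier (tuple_norm D) (unknowns D)"
proof
  show "csubspace (unknowns D)"
    by (rule unknowns_subspace)
  show "0 \<le> tuple_norm D u" for u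
    by (simp add: tuple_norm_def sum_nonneg)
  show "tuple_norm D (u + v) \<le> tuple_norm D u + tuple_norm D v" for u v
    by (simp add: tuple_norm_def flip: sum.distrib) (intro sum_mono norm_triangle_ineq)
  show "tuple_norm D (c *\<^sub>C u) = cmod c * tuple_norm D u" for c u
    by (simp add: tuple_norm_def scaleC_fun_def norm_scaleC sum_distrib_left)
  show "u = 0" if "u \<in> unknowns D" "tuple_norm D u = 0" for u
  proof
    fix p
    show "u p = 0 p"
      using that norm_le_tuple_norm[of p u] by (cases "p \<in> positions D") (auto simp: unknowns_def)
  qed
qed

text \<open>A Cauchy sequence of tuples converges componentwise, and the limit is again a tuple of
  unknowns because the interface spaces are closed.\<close>

lemma complete_unknowns: "complete_carrier (tuple_norm D) (unknowns D)"
proof -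
  interpret normed_carrier "tuple_norm D" "unknowns D"
    by (rule normed_unknowns)
  interpret M: Metric_space "unknowns D" "\<lambda>u v. tuple_norm D (u - v)"
    by (rule metric)
  have "M.mcomplete"
    unfolding M.mcomplete_def
  proof (intro allI impI)
    fix s assume s: "M.MCauchy s"
    then have sX: "s n \<in> unknowns D" for n
      by (auto simp: M.MCauchy_def)
    define l where "l p = (if p \<in> positions D then lim (\<lambda>n. s n p) else 0)" for p
    have lim: "(\<lambda>n. s n p) \<longlonglongrightarrow> l p" if p: "p \<in> positions D" for p
    proof -
      have "Cauchy (\<lambda>n. s n p)"
      proof (rule CauchyI)
        fix e :: real assume "0 < e"
        then obtain n0 where "\<forall>m n. n0 \<le> m \<longrightarrow> n0 \<le> n \<longrightarrow> tuple_norm D (s m - s n) < e"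
          using s unfolding M.MCauchy_def by blast
        moreover have "norm (s m p - s n p) \<le> tuple_norm D (s m - s n)" for m n
          using norm_le_tuple_norm[OF p, of "s m - s n"] by simp
        ultimately show "\<exists>n0. \<forall>m\<ge>n0. \<forall>n\<ge>n0. norm (s m p - s n p) < e"
          by (meson le_less_trans)
      qed
      then show ?thesis
        using p by (simp add: l_def Cauchy_convergent convergent_LIMSEQ_iff[symmetric])
    qed
    have "l p \<in> position_space D p" if p: "p \<in> positions D" for p
      by (rule closed_sequentially[OF position_space(2)[OF p] _ lim[OF p]])
        (use sX p in \<open>simp add: unknowns_def\<close>)
    then have lX: "l \<in> unknowns D"
      by (simp add: unknowns_def l_def)
    have "(\<lambda>n. norm (s n p - l p)) \<longlonglongrightarrow> 0" if "p \<in> positions D" for p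
      using lim[OF that] by (simp add: LIM_zero tendsto_norm_zero)
    then have "(\<lambda>n. tuple_norm D (s n - l)) \<longlonglongrightarrow> 0"
      unfolding tuple_norm_def by (intro tendsto_null_sum) auto
    then show "\<exists>l. limitin M.mtopology s l sequentially"
      using lX sX by (auto simp: M.limitin_metric_dist_null)
  qed
  then show ?thesis
    by unfold_locales
qed

lemma bounded_T_LR: "bounded_op_on (tuple_norm D) (unknowns D) (T_LR D)"
proof -
  interpret normed_carrier "tuple_norm D" "unknowns D"
    by (rule normed_unknowns)
  have ent: "h \<in> position_space D q \<Longrightarrow> T_matrix D p q h \<in> position_space D p"
      "h \<in> position_space D q \<Longrightarrow> g \<in> position_space D q \<Longrightarrow>
        T_matrix D p q (h + g) = T_matrix D p q h + T_matrix D p q g"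
      "h \<in> position_space D q \<Longrightarrow> T_matrix D p q (c *\<^sub>C h) = c *\<^sub>C T_matrix D p q h"
    if "p \<in> positions D" "q \<in> positions D" for p q h g c
    using T_matrix_linear[OF that] by (auto simp: linear_between_def clinear_on_def)
  have comp: "u q \<in> position_space D q" if "u \<in> unknowns D" "q \<in> positions D" for u q
    using that by (simp add: unknowns_def)
  have scaleC_sum: "c *\<^sub>C sum f A = (\<Sum>q\<in>A. c *\<^sub>C f q)" for c and f :: "nat \<Rightarrow> 'h" and A
    by (induction A rule: infinite_finite_induct) (simp_all add: scaleC_add_right)
  have "\<forall>p\<in>positions D. \<forall>q\<in>positions D. \<exists>K. \<forall>h\<in>position_space D q. norm (T_matrix D p q h) \<le> K * norm h"
    using components(5) by (simp add: bounded_entries_def)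
  then obtain K where K: "norm (T_matrix D p q h) \<le> K p q * norm h"
    if "p \<in> positions D" "q \<in> positions D" "h \<in> position_space D q" for p q h
    by (metis (no_types))
  show ?thesis
  proof (rule bopI)
    fix u v assume u: "u \<in> unknowns D" and v: "v \<in> unknowns D"
    then show "T_LR D (u + v) = T_LR D u + T_LR D v"
      by (simp add: T_LR_def matrix_op_def fun_eq_iff ent comp flip: sum.distrib)
  next
    fix c u assume u: "u \<in> unknowns D"
    then show "T_LR D (c *\<^sub>C u) = c *\<^sub>C T_LR D u"
      by (simp add: T_LR_def matrix_op_def fun_eq_iff scaleC_fun_def ent comp scaleC_sum)
  next
    fix u assume u: "u \<in> unknowns D"
    have "T_LR D u p \<in> position_space D p" if "p \<in> positions D" for p
      using that by (auto simp: T_LR_def matrix_op_def intro!: csubspace_sum position_space ent(1) comp[OF u])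
    then show "T_LR D u \<in> unknowns D"
      by (simp add: unknowns_def T_LR_def matrix_op_def)
    have "tuple_norm D (T_LR D u) \<le> (\<Sum>p\<in>positions D. \<Sum>q\<in>positions D. \<bar>K p q\<bar> * tuple_norm D u)"
      unfolding tuple_norm_def[of D "T_LR D u"]
    proof (rule sum_mono)
      fix p assume p: "p \<in> positions D"
      have "norm (T_LR D u p) \<le> (\<Sum>q\<in>positions D. norm (T_matrix D p q (u q)))"
        using p by (simp add: T_LR_def matrix_op_def norm_sum)
      also have "\<dots> \<le> (\<Sum>q\<in>positions D. \<bar>K p q\<bar> * tuple_norm D u)"
      proof (rule sum_mono)
        fix q assume q: "q \<in> positions D"
        have "norm (T_matrix D p q (u q)) \<le> K p q * norm (u q)"
          by (rule K[OF p q comp[OF u q]])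
        also have "\<dots> \<le> \<bar>K p q\<bar> * tuple_norm D u"
          by (intro mult_mono norm_le_tuple_norm q) auto
        finally show "norm (T_matrix D p q (u q)) \<le> \<bar>K p q\<bar> * tuple_norm D u" .
      qed
      finally show "norm (T_LR D u p) \<le> (\<Sum>q\<in>positions D. \<bar>K p q\<bar> * tuple_norm D u)" .
    qed
    then show "tuple_norm D (T_LR D u) \<le> (\<Sum>p\<in>positions D. \<Sum>q\<in>positions D. \<bar>K p q\<bar>) * tuple_norm D u"
      by (simp add: sum_distrib_right)
  qed
qed

section \<open>The diagonal blocks\<close>

definition restrict_to :: "nat set \<Rightarrow> (nat \<Rightarrow> 'h) \<Rightarrow> nat \<Rightarrow> 'h" where
  "restrict_to A u = (\<lambda>p. if p \<in> A then u p else 0)"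

abbreviation "left_block \<equiv> {1..nstrips D - 1}"
abbreviation "right_block \<equiv> {nstrips D..2 * nstrips D - 2}"

lemma positions_blocks: "positions D = left_block \<union> right_block" "left_block \<inter> right_block = {}"
  using N by (auto simp: positions_def)

lemma bounded_restrict_to: "bounded_op_on (tuple_norm D) (unknowns D) (restrict_to A)"
proof -
  interpret normed_carrier "tuple_norm D" "unknowns D"
    by (rule normed_unknowns)
  show ?thesis
  proof (rule bopI[where K = 1])
    show "restrict_to A u \<in> unknowns D" if "u \<in> unknowns D" for u
      using that position_space(1) by (auto simp: unknowns_def restrict_to_def csubspace_iff)
    show "tuple_norm D (restrict_to A u) \<le> 1 * tuple_norm D u" for u
      unfolding tuple_norm_def by (auto simp: restrict_to_def intro!: sum_mono)
  qed (auto simp: restrict_to_def scaleC_fun_def fun_eq_iff)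
qed

lemma scalar_matrix_op_diagonal:
  assumes "A \<subseteq> positions D"
  shows "scalar_matrix_op D (\<lambda>p q. if p = q \<and> p \<in> A then 1 else 0) = restrict_to A"
proof (intro ext)
  fix u :: "nat \<Rightarrow> 'h" and p
  have "(\<Sum>q\<in>positions D. (if p = q \<and> p \<in> A then 1 else 0) *\<^sub>C u q) =
      (\<Sum>q\<in>positions D. if p = q then (if p \<in> A then u q else 0) else 0)"
    by (intro sum.cong) (auto simp: scaleC_one)
  then show "scalar_matrix_op D (\<lambda>p q. if p = q \<and> p \<in> A then 1 else 0) u p = restrict_to A u p"
    using assms by (auto simp: scalar_matrix_op_def matrix_op_def restrict_to_def sum.delta)
qed

lemma scalar_blocks:
  "scalar_matrix_op D (I_l D) = restrict_to left_block"
  "scalar_matrix_op D (transp (I_l D)) = restrict_to left_block"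
  "scalar_matrix_op D (I_r D) = restrict_to right_block"
  "scalar_matrix_op D (transp (I_r D)) = restrict_to right_block"
proof -
  have "I_l D = (\<lambda>p q. if p = q \<and> p \<in> left_block then 1 else 0)"
      "transp (I_l D) = (\<lambda>p q. if p = q \<and> p \<in> left_block then 1 else 0)"
      "I_r D = (\<lambda>p q. if p = q \<and> p \<in> right_block then 1 else 0)"
      "transp (I_r D) = (\<lambda>p q. if p = q \<and> p \<in> right_block then 1 else 0)"
    by (auto simp: fun_eq_iff I_l_def I_r_def transp_def)
  then show
    "scalar_matrix_op D (I_l D) = restrict_to left_block"
    "scalar_matrix_op D (transp (I_l D)) = restrict_to left_block"
    "scalar_matrix_op D (I_r D) = restrict_to right_block"
    "scalar_matrix_op D (transp (I_r D)) = restrict_to right_block"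
    using scalar_matrix_op_diagonal[of left_block] scalar_matrix_op_diagonal[of right_block]
      positions_blocks(1) by simp_all
qed

text \<open>Information moves to the next strip on the right inside the left block and to the next strip
  on the left inside the right block; as the right interfaces are numbered backwards, both raise
  the position by one.\<close>

lemma T_matrix_same_block:
  assumes "p \<in> A" "q \<in> A" "A = left_block \<or> A = right_block" "p \<noteq> q + 1"
  shows "T_matrix D p q = (\<lambda>h. 0)"
  using assms(3)
proof
  assume "A = left_block"
  then have "lr_index (nstrips D) p = (p + 1, Lft)" "lr_index (nstrips D) q = (q + 1, Lft)"
    using assms(1,2) by (simp_all add: lr_index_def)
  then show ?thesis
    using assms(4) by (simp add: T_matrix_def)
next
  assume "A = right_block"
  then have bounds: "nstrips D \<le> p" "p \<le> 2 * nstrips D - 2" "nstrips D \<le> q" "q \<le> 2 * nstrips D - 2"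
    using assms(1,2) by simp_all
  then have "\<not> p \<le> nstrips D - 1" "\<not> q \<le> nstrips D - 1"
    using N by linarith+
  then have "lr_index (nstrips D) p = (2 * nstrips D - 1 - p, Rgt)"
      "lr_index (nstrips D) q = (2 * nstrips D - 1 - q, Rgt)"
    by (simp_all only: lr_index_def if_False)
  moreover have "2 * nstrips D - 1 - p \<noteq> 2 * nstrips D - 1 - q - 1"
    using bounds assms(4) N by arith
  ultimately show ?thesis
    by (simp add: T_matrix_def)
qed

text \<open>Each application of a strictly lower triangular block clears one more leading position. A tuple
  has no component at position \<open>0\<close>, which starts the induction, and none beyond the last position,
  so the power given by the number of positions vanishes. This exponent is cruder than the block
  size, but it serves both blocks alike.\<close>

lemma diagonal_block_nilpotent:
  assumes A: "A = left_block \<or> A = right_block" and u: "u \<in> unknowns D"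
  shows "((\<lambda>v. restrict_to A (T_LR D (restrict_to A v))) ^^ (2 * nstrips D - 2)) u = 0"
proof -
  interpret normed_carrier "tuple_norm D" "unknowns D"
    by (rule normed_unknowns)
  define M where "M = (\<lambda>v. restrict_to A (T_LR D (restrict_to A v)))"
  have M: "bop M"
    unfolding M_def by (rule bop_compose[OF bounded_restrict_to bop_compose[OF bounded_T_LR bounded_restrict_to]])
  have zero: "T_matrix D p q 0 = 0" if "p \<in> positions D" "q \<in> positions D" for p q
  proof -
    have "T_matrix D p q (0 *\<^sub>C 0) = 0 *\<^sub>C T_matrix D p q 0"
      using T_matrix_linear[OF that] position_space(1)[OF that(2)]
      unfolding linear_between_def clinear_on_def csubspace_iff by blast
    then show ?thesis
      by simp
  qed
  have shift: "M v p = 0" if v: "\<And>q. q \<le> n \<Longrightarrow> v q = 0" and p: "p \<le> Suc n" for v n p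
  proof -
    have "T_matrix D p q (restrict_to A v q) = 0"
      if pq: "p \<in> A" "p \<in> positions D" "q \<in> positions D" for q
    proof (cases "q \<in> A \<and> p = q + 1")
      case True
      then have "v q = 0"
        using v p by simp
      then show ?thesis
        using zero[OF pq(2,3)] by (simp add: restrict_to_def)
    next
      case False
      then show ?thesis
        using zero[OF pq(2,3)] T_matrix_same_block[OF pq(1) _ A] by (auto simp: restrict_to_def)
    qed
    then show ?thesis
      unfolding M_def
      by (subst restrict_to_def) (auto simp: T_LR_def matrix_op_def intro!: sum.neutral)
  qed
  have iter: "(M ^^ n) u \<in> unknowns D \<and> (\<forall>q\<le>n. (M ^^ n) u q = 0)" for n
  proof (induction n)
    case 0
    then show ?case
      using u by (simp add: unknowns_def positions_def)
  next
    case (Suc n)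
    then show ?case
      using shift[of n "(M ^^ n) u"] bop_in[OF M] by simp
  qed
  have "(M ^^ (2 * nstrips D - 2)) u p = 0" for p
    using iter[of "2 * nstrips D - 2"] by (cases "p \<le> 2 * nstrips D - 2") (auto simp: unknowns_def positions_def)
  then show ?thesis
    by (simp add: M_def fun_eq_iff)
qed

theorem spectral_radius_R_BJ_le:
  "spectral_radius D (R_BJ D) \<le> sqrt (spectral_radius D (C_r D \<circ> C_l D))"
proof -
  interpret complete_carrier "tuple_norm D" "unknowns D"
    by (rule complete_unknowns)
  define El Er T where "El = restrict_to left_block" and "Er = restrict_to right_block" and "T = T_LR D"
  have El: "bop El" and Er: "bop Er" and T: "bop T"
    by (simp_all add: El_def Er_def T_def bounded_restrict_to bounded_T_LR)
  have blocks: "M_l D = (\<lambda>u. El (T (El u)))" "A_l D = (\<lambda>u. El (T (Er u)))"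
      "A_r D = (\<lambda>u. Er (T (El u)))" "M_r D = (\<lambda>u. Er (T (Er u)))"
    by (simp_all add: M_l_def A_l_def A_r_def M_r_def scalar_blocks El_def Er_def T_def comp_def)
  have sum: "El u + Er u = u" if "u \<in> unknowns D" for u
    using that positions_blocks by (auto simp: El_def Er_def restrict_to_def unknowns_def fun_eq_iff)
  have lr: "El (Er u) = 0" and rl: "Er (El u) = 0" for u
    using positions_blocks(2) by (auto simp: El_def Er_def restrict_to_def fun_eq_iff)
  obtain Gl where Gl: "inverse_on_carrier (\<lambda>u. u - El (T (El u))) Gl"
    using nilpotent_inverse[OF bop_compose[OF El bop_compose[OF T El]]] diagonal_block_nilpotent
    unfolding El_def T_def by blast
  obtain Gr where Gr: "inverse_on_carrier (\<lambda>u. u - Er (T (Er u))) Gr"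
    using nilpotent_inverse[OF bop_compose[OF Er bop_compose[OF T Er]]] diagonal_block_nilpotent
    unfolding Er_def T_def by blast
  define Cl where "Cl u = Gl (El (T (Er u)))" for u
  define Cr where "Cr u = Gr (Er (T (El u)))" for u
  have Gs: "bop Gl" "bop Gr"
    using Gl Gr by (simp_all add: inverse_on_carrier_def)
  have Cl: "bop Cl"
    unfolding Cl_def by (rule bop_compose[OF Gs(1) bop_compose[OF El bop_compose[OF T Er]]])
  have Cr: "bop Cr"
    unfolding Cr_def by (rule bop_compose[OF Gs(2) bop_compose[OF Er bop_compose[OF T El]]])
  have ErCl: "Er (Cl u) = 0" if "u \<in> unknowns D" for u
    unfolding Cl_def using block_solve_range[OF El Er T rl Gl that] .
  have ElCr: "El (Cr u) = 0" if "u \<in> unknowns D" for u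
    unfolding Cr_def using block_solve_range[OF Er El T lr Gr that] .
  have ClCl: "Cl (Cl u) = 0" if "u \<in> unknowns D" for u
    by (subst Cl_def) (simp add: ErCl[OF that] bop_zero[OF El] bop_zero[OF T] bop_zero[OF Gs(1)])
  have CrCr: "Cr (Cr u) = 0" if "u \<in> unknowns D" for u
    by (subst Cr_def) (simp add: ElCr[OF that] bop_zero[OF Er] bop_zero[OF T] bop_zero[OF Gs(2)])
  have C_l_eq: "C_l D u = Cl u" if "u \<in> unknowns D" for u
  proof -
    have "id - M_l D = (\<lambda>u. u - El (T (El u)))"
      by (simp add: blocks fun_eq_iff)
    then show ?thesis
      using inv_into_eq[OF Gl] that by (simp add: C_l_def op_inverse_def blocks Cl_def bop_in[OF El] bop_in[OF Er] bop_in[OF T])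
  qed
  have C_r_eq: "C_r D u = Cr u" if "u \<in> unknowns D" for u
  proof -
    have "id - M_r D = (\<lambda>u. u - Er (T (Er u)))"
      by (simp add: blocks fun_eq_iff)
    then show ?thesis
      using inv_into_eq[OF Gr] that by (simp add: C_r_def op_inverse_def blocks Cr_def bop_in[OF El] bop_in[OF Er] bop_in[OF T])
  qed
  have R_eq: "R_BJ D u = Cl u + Cr u" if "u \<in> unknowns D" for u
  proof -
    have P: "id - M_r D - M_l D = (\<lambda>u. u - Er (T (Er u)) - El (T (El u)))"
      by (simp add: blocks fun_eq_iff)
    have "(id - M_r D - M_l D - (id - T_LR D)) u = T u - Er (T (Er u)) - El (T (El u))"
      by (simp add: blocks T_def)
    then have "R_BJ D u = inv_into (unknowns D) (\<lambda>u. u - Er (T (Er u)) - El (T (El u)))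
        (T u - Er (T (Er u)) - El (T (El u)))"
      by (simp only: R_BJ_def error_propagation_def op_inverse_def P comp_apply)
    also have "\<dots> = Cl u + Cr u"
      unfolding Cl_def Cr_def by (rule block_jacobi_splitting[OF El Er T sum lr rl Gl Gr that])
    finally show ?thesis .
  qed
  have "spectral_radius D (R_BJ D) = spectral_radius_on (tuple_norm D) (unknowns D) (\<lambda>u. Cl u + Cr u)"
    unfolding spectral_radius_def spectral_radius_on_def using spectrum_cong[OF R_eq] by simp
  moreover have "spectral_radius D (C_r D \<circ> C_l D) = spectral_radius_on (tuple_norm D) (unknowns D) (\<lambda>u. Cr (Cl u))"
    unfolding spectral_radius_def spectral_radius_on_def
    using spectrum_cong[of "C_r D \<circ> C_l D" "\<lambda>u. Cr (Cl u)"] by (simp add: C_l_eq C_r_eq bop_in[OF Cl])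
  ultimately show ?thesis
    using spectral_radius_sum_square_zero[OF Cl Cr ClCl CrCr] by simp
qed

end

theorem mainTheorem5:
  fixes D :: "('h::complex_banach, 'b::complex_vector) strip_problem"
  assumes "2 \<le> nstrips D"
    and "helmholtz_strips D"
  shows "spectral_radius D (R_BJ D) \<le> sqrt (spectral_radius D (C_r D \<circ> C_l D))"
proof -
  interpret strip_system D
    using assms by unfold_locales
  show ?thesis
    by (rule spectral_radius_R_BJ_le)
qed

end
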